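(* Let $(\mathcal{X},\mathcal{A},P)$ be a probability space, $f\in L_2(P)$ real-valued, and $h=(h_1,\ldots,h_m)^T$ a vector of control variates $h_j\in L_2(P)$ with $P(h_j)=0$ for all $j$. Fix a minimizer $\beta^\star(f)\in\arg\min_{\beta\in\mathbb{R}^m}P[(f-P(f)-\beta^Th)^2]$ and let $\epsilon=f-P(f)-\beta^\star(f)^Th$. Assume: (i) $\epsilon\in\mathcal{G}(\tau^2)$ for some $\tau>0$; (ii) the control variates are uniformly bounded, with $U_h:=\max_{j}\sup_{x\in\mathcal{X}}|h_j(x)|<\infty$; (iii) $h_1,\ldots,h_m$ are linearly independent in $L_2(P)$, so that $G:=P(hh^T)$ is positive definite. Let $B=\sup_{x\in\mathcal{X}}h(x)^TG^{-1}h(x)$. Let $X_1,\ldots,X_n$ be i.i.d. with distribution $P$ and let $\hat\alpha_n^{\mathrm{ols}}(f)$ be the OLS control variate estimator. Then for all $\delta\in(0,1)$ and every integer $n$ with $$n\ge\max\bigl(18B\log(4m/\delta),\;75m\log(4/\delta)\bigr),$$ with probability at least $1-\delta$, $$|\hat\alpha_n^{\mathrm{ols}}(f)-P(f)|\le\sqrt{2\log(8/\delta)}\frac{\tau}{\sqrt n}+58\sqrt{Bm\log(8m/\delta)\log(4/\delta)}\,\frac{\tau}{n}.$$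
   Context: $P(g)=\int g\,dP$ and $P_n(g)=n^{-1}\sum_{i=1}^n g(X_i)$. A centered random variable $Y$ is sub-Gaussian with variance factor $\tau^2$, written $Y\in\mathcal{G}(\tau^2)$, if $\log\mathbb{E}[\exp(\lambda Y)]\le\lambda^2\tau^2/2$ for all $\lambda\in\mathbb{R}$; for a function $\epsilon$ on $\mathcal{X}$, $\epsilon\in\mathcal{G}(\tau^2)$ means $\int\exp\{\lambda\epsilon(x)\}P(dx)\le\exp(\lambda^2\tau^2/2)$ for all $\lambda$. Let $f^{(n)}=(f(X_1),\ldots,f(X_n))^T$, $H=(h_j(X_i))_{i\le n,j\le m}$, $\mathbb{1}_n=(1,\ldots,1)^T$. The OLS estimator is defined by $(\hat\alpha_n^{\mathrm{ols}}(f),\hat\beta_n^{\mathrm{ols}}(f))\in\arg\min_{(\alpha,\beta)\in\mathbb{R}\times\mathbb{R}^m}\|f^{(n)}-\alpha\mathbb{1}_n-H\beta\|_2^2$; equivalently $\hat\alpha_n^{\mathrm{ols}}(f)=P_n[f-\hat\beta_n^{\mathrm{ols}}(f)^Th]$ with $\hat\beta_n^{\mathrm{ols}}(f)\in\arg\min_\beta\|f_c^{(n)}-H_c\beta\|_2^2$, where $f_c^{(n)}=f^{(n)}-\mathbb{1}_n(\mathbb{1}_n^Tf^{(n)})/n$ and $H_c=H-\mathbb{1}_n(\mathbb{1}_n^TH)/n$. *)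

theory Defs
  imports "HOL-Probability.Probability"
begin

text \<open>Sub-Gaussianity of a function eps on a probability space, as in the paper:
  \<integral> exp(\<lambda> eps) dP \<le> exp(\<lambda>^2 \<tau>^2 / 2) for all real \<lambda>.
  We use the nonnegative integral so that non-integrability cannot make it vacuous.\<close>
definition subgaussian_fun :: "'a measure \<Rightarrow> ('a \<Rightarrow> real) \<Rightarrow> real \<Rightarrow> bool" where
  "subgaussian_fun M eps tau2 \<longleftrightarrow> eps \<in> borel_measurable M \<and>
     (\<forall>l::real. (\<integral>\<^sup>+ x. ennreal (exp (l * eps x)) \<partial>M) \<le> ennreal (exp (l\<^sup>2 * tau2 / 2)))"

definition ols_minimizer ::
  "nat \<Rightarrow> (nat \<Rightarrow> 'a) \<Rightarrow> ('a \<Rightarrow> real) \<Rightarrow> ('a \<Rightarrow> real ^ 'm) \<Rightarrow> real \<Rightarrow> real ^ 'm \<Rightarrow> bool" where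
  "ols_minimizer n X f h a b \<longleftrightarrow>
     (\<forall>a' b'. (\<Sum>i<n. (f (X i) - a - b \<bullet> h (X i))\<^sup>2) \<le> (\<Sum>i<n. (f (X i) - a' - b' \<bullet> h (X i))\<^sup>2))"

definition gram :: "'a measure \<Rightarrow> ('a \<Rightarrow> real ^ 'm) \<Rightarrow> real ^ 'm ^ 'm" where
  "gram M h = (\<chi> j k. \<integral> x. h x $ j * h x $ k \<partial>M)"

end

theory Submission
  imports Defs
begin

text \<open>
  Whiten the control variates: with \<open>u = G\<^sup>-\<^sup>1\<^sup>/\<^sup>2 h\<close> we have \<open>\<integral> u u\<^sup>T = I\<close> and \<open>\<parallel>u\<parallel>\<^sup>2 \<le> B\<close>. Writing \<open>\<gamma>\<close> for
  the error of the fitted slope in these coordinates, the normal equations turn the estimation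
  error into \<open>P\<^sub>n \<epsilon> - \<gamma> \<bullet> P\<^sub>n u\<close>, where \<open>\<parallel>\<gamma>\<parallel>\<close> is controlled by \<open>P\<^sub>n u\<close>, \<open>P\<^sub>n (u \<epsilon>)\<close>, \<open>P\<^sub>n \<epsilon>\<close>
  and the least eigenvalue of \<open>P\<^sub>n (u u\<^sup>T)\<close>. Each of these four quantities gets a share \<open>\<delta> / 4\<close> of the
  failure probability.

  The eigenvalue bound is a matrix Chernoff inequality. The usual trace exponential is replaced by
  \<open>tr (A\<^sup>-\<^sup>p)\<close> for \<open>A = I + (B p)\<^sup>-\<^sup>1 \<Sum> u\<^sub>i u\<^sub>i\<^sup>T\<close> and \<open>p = 10 n\<close>, since the effect of a rank-one
  update on this potential follows from the Sherman-Morrison formula and the log-convexity of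
  moments, with no trace inequality of Golden-Thompson type. The vector sums are bounded by the
  potential \<open>cosh (\<lambda> \<parallel>S\<parallel>)\<close>, following Pinelis.
\<close>

section \<open>Rank-one downdates of positive definite operators\<close>

text \<open>Operators are plain functions on a Euclidean space, so that powers are iterates
  \<open>^^\<close> and rank-one updates are written without matrices.\<close>

definition pd_op :: "('b::euclidean_space \<Rightarrow> 'b) \<Rightarrow> bool" where
  "pd_op Q \<longleftrightarrow> linear Q \<and> (\<forall>x y. Q x \<bullet> y = x \<bullet> Q y) \<and> (\<forall>x. x \<noteq> 0 \<longrightarrow> 0 < x \<bullet> Q x)"

lemma pd_opI:
  assumes "linear Q" "\<And>x y. Q x \<bullet> y = x \<bullet> Q y" "\<And>x. x \<noteq> 0 \<Longrightarrow> 0 < x \<bullet> Q x"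
  shows "pd_op Q"
  using assms by (auto simp: pd_op_def)

lemma pd_opD:
  assumes "pd_op Q"
  shows "linear Q" "Q x \<bullet> y = x \<bullet> Q y" "x \<noteq> 0 \<Longrightarrow> 0 < x \<bullet> Q x" "0 \<le> x \<bullet> Q x"
  using assms by (auto simp: pd_op_def) (metis inner_zero_left less_eq_real_def)

lemma pd_op_eq_0_iff: "pd_op Q \<Longrightarrow> Q x = 0 \<longleftrightarrow> x = 0"
  by (metis inner_zero_right linear_0 order_less_irrefl pd_opD(1,3))

section \<open>Powers of positive definite operators\<close>

lemma linear_funpow: "linear Q \<Longrightarrow> linear (Q ^^ k)" for Q :: "'b::real_vector \<Rightarrow> 'b"
  by (induction k) (simp_all add: linear_id linear_compose linear_compose[unfolded comp_def])

lemma selfadj_funpow: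
  assumes "\<And>x y. Q x \<bullet> y = x \<bullet> Q y"
  shows "(Q ^^ k) x \<bullet> y = x \<bullet> (Q ^^ k) y"
  using assms by (induction k arbitrary: x y) (simp_all add: funpow_swap1)

text \<open>Induction in steps of two: for \<open>k = j + 2\<close>, self-adjointness gives
  \<open>x \<bullet> (Q ^^ k) x = Q x \<bullet> (Q ^^ j) (Q x)\<close>, and \<open>Q x\<close> is
  nonzero. No square root of \<open>Q\<close> is involved.\<close>

lemma pd_op_funpow:
  assumes "pd_op Q"
  shows "pd_op (Q ^^ k)"
proof (induction k rule: less_induct)
  case (less k)
  have lin: "linear (Q ^^ k)" and sym: "\<And>x y. (Q ^^ k) x \<bullet> y = x \<bullet> (Q ^^ k) y"
    using linear_funpow selfadj_funpow pd_opD[OF assms] by blast+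
  consider "k = 0" | "k = 1" | j where "k = Suc (Suc j)"
    by (metis One_nat_def not0_implies_Suc)
  then show ?case
  proof cases
    case 3
    have IH: "pd_op (Q ^^ j)"
      using less 3 by simp
    show ?thesis
    proof (rule pd_opI[OF lin sym])
      fix x :: 'a assume "x \<noteq> 0"
      then have "0 < Q x \<bullet> (Q ^^ j) (Q x)"
        using pd_opD(3)[OF IH] pd_op_eq_0_iff[OF assms] by blast
      also have "\<dots> = x \<bullet> (Q ^^ k) x"
        by (simp add: 3 pd_opD(2)[OF assms] funpow_swap1)
      finally show "0 < x \<bullet> (Q ^^ k) x" .
    qed
  next
    case 1
    then show ?thesis by (simp add: pd_op_def linear_id[unfolded id_def])
  next
    case 2
    then show ?thesis using assms by (simp add: comp_def)
  qed
qed

section \<open>Cauchy-Schwarz and log-convexity of moments\<close>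

lemma pd_op_Cauchy_Schwarz:
  assumes "pd_op Q"
  shows "(x \<bullet> Q y)\<^sup>2 \<le> (x \<bullet> Q x) * (y \<bullet> Q y)"
proof (cases "y = 0")
  case True
  then show ?thesis
    using pd_op_eq_0_iff[OF assms, of 0] by simp
next
  case False
  define t where "t = (x \<bullet> Q y) / (y \<bullet> Q y)"
  have pos: "y \<bullet> Q y > 0"
    using pd_opD(3)[OF assms False] .
  have "0 \<le> (x - t *\<^sub>R y) \<bullet> Q (x - t *\<^sub>R y)"
    by (rule pd_opD(4)[OF assms])
  also have "\<dots> = x \<bullet> Q x - 2 * t * (x \<bullet> Q y) + t\<^sup>2 * (y \<bullet> Q y)"
    using pd_opD(2)[OF assms, of y x]
    by (simp add: linear_diff linear_scale pd_opD(1)[OF assms] inner_diff algebra_simps power2_eq_square inner_commute)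
  also have "\<dots> = x \<bullet> Q x - (x \<bullet> Q y)\<^sup>2 / (y \<bullet> Q y)"
    using pos by (simp add: t_def field_simps power2_eq_square)
  finally show ?thesis
    using pos by (simp add: field_simps)
qed

text \<open>Cauchy-Schwarz for the form of \<open>Q ^^ k\<close>, applied to \<open>v\<close> and
  \<open>Q v\<close>.\<close>

lemma pd_op_moment_log_convex:
  assumes "pd_op Q"
  shows "(v \<bullet> (Q ^^ Suc k) v)\<^sup>2 \<le> (v \<bullet> (Q ^^ k) v) * (v \<bullet> (Q ^^ Suc (Suc k)) v)"
  using pd_op_Cauchy_Schwarz[OF pd_op_funpow[OF assms], of v k "Q v"]
  by (simp add: funpow_swap1 pd_opD(2)[OF assms])

lemma pd_op_moment_pos: "pd_op Q \<Longrightarrow> v \<noteq> 0 \<Longrightarrow> 0 < v \<bullet> (Q ^^ k) v"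
  using pd_opD(3) pd_op_funpow by blast

text \<open>Sherman-Morrison: if \<open>Q\<close> is the inverse of a self-adjoint \<open>A\<close>,
  this is the inverse of \<open>A\<close> plus the rank-one operator sending \<open>x\<close> to
  \<open>(v \<bullet> x) *\<^sub>R v\<close>.\<close>

definition downdate :: "('b \<Rightarrow> 'b) \<Rightarrow> 'b \<Rightarrow> 'b::real_inner \<Rightarrow> 'b" where
  "downdate Q v x = Q x - ((Q v \<bullet> x) / (1 + v \<bullet> Q v)) *\<^sub>R Q v"

definition trc :: "('b \<Rightarrow> 'b::euclidean_space) \<Rightarrow> real" where
  "trc F = (\<Sum>b\<in>Basis. b \<bullet> F b)"

lemma linear_downdate: "linear Q \<Longrightarrow> linear (downdate Q v)"
  by (rule linearI) (simp_all add: downdate_def linear_add linear_scale inner_add_right algebra_simps add_divide_distrib)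

lemma selfadj_downdate:
  assumes "\<And>x y. Q x \<bullet> y = x \<bullet> Q y"
  shows "downdate Q v x \<bullet> y = x \<bullet> downdate Q v y"
  using assms[of x y] by (simp add: downdate_def inner_diff inner_commute)

text \<open>One downdate expanded inside a mixed moment. This is the recursion \<open>rec\<close>
  required by \<open>moment_ratio_bound\<close>, with the pure moments of \<open>v\<close> as
  \<open>a\<close>.\<close>

lemma mixed_moment_recursion:
  assumes "\<And>x y. Q x \<bullet> y = x \<bullet> Q y" and "linear Q"
  shows "v \<bullet> (Q ^^ k) ((downdate Q v ^^ Suc l) v)
       = v \<bullet> (Q ^^ Suc k) ((downdate Q v ^^ l) v)
         - (v \<bullet> (Q ^^ Suc k) v) * (v \<bullet> (Q ^^ 1) ((downdate Q v ^^ l) v)) / (1 + v \<bullet> (Q ^^ 1) v)"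
proof -
  interpret linear "Q ^^ k" using linear_funpow[OF assms(2)] .
  show ?thesis
    using assms(1)[of v "(downdate Q v ^^ l) v"]
    by (simp add: downdate_def[of Q v "(downdate Q v ^^ l) v"] diff scale inner_diff funpow_swap1[of Q] mult.commute)
qed

text \<open>The ratio of mixed to pure moments is increasing in the power of \<open>Q\<close>, because the
  ratio \<open>a (k + 1) / a k\<close> is. This makes the recursion for mixed moments a lower bound.\<close>
lemma moment_ratio_bound:
  fixes a :: "nat \<Rightarrow> real" and d :: "nat \<Rightarrow> nat \<Rightarrow> real"
  assumes pos: "\<And>k. 0 < a k"
    and lc: "\<And>k. (a (Suc k))\<^sup>2 \<le> a k * a (Suc (Suc k))"
    and d0: "\<And>k. d 0 k = a k"
    and rec: "\<And>l k. d (Suc l) k = d l (Suc k) - a (Suc k) * d l 1 / (1 + a 1)"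
  shows "1 \<le> k \<Longrightarrow> a (k + l) / (1 + a 1) ^ l \<le> d l k"
proof -
  have r_mono: "a (Suc k) / a k \<le> a (Suc (Suc k)) / a (Suc k)" for k
    using lc[of k] pos[of k] pos[of "Suc k"] by (simp add: field_simps power2_eq_square)
  have rec': "d (Suc l) k / a k = a (Suc k) / a k * (d l (Suc k) / a (Suc k) - a 1 / (1 + a 1) * (d l 1 / a 1))" for l k
    using pos[of k] pos[of "Suc k"] pos[of 1] by (simp add: rec divide_simps add_pos_pos)
  define c where "c = a 1 / (1 + a 1)"
  have c: "0 \<le> c" "c \<le> 1" "1 - c = 1 / (1 + a 1)"
    using pos[of 1] by (auto simp: c_def field_simps)
  \<comment> \<open>Both claims need one joint induction. Increasing ratios make
    \<open>d l 1 / a 1\<close> the smallest, so at least the fraction \<open>1 - c\<close> survives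
    the subtraction in \<open>rec'\<close>; the lower bound keeps the bracket there nonnegative, so
    that the product of increasing factors is again increasing.\<close>
  have step: "(\<forall>k\<ge>1. d l k / a k \<le> d l (Suc k) / a (Suc k)) \<and> (\<forall>k\<ge>1. a (k + l) / (1 + a 1) ^ l \<le> d l k)" for l
  proof (induction l)
    case 0
    then show ?case using pos by (simp add: d0 less_imp_neq[symmetric])
  next
    case (Suc l)
    then have mono: "\<And>k. k \<ge> 1 \<Longrightarrow> d l k / a k \<le> d l (Suc k) / a (Suc k)"
      and low: "\<And>k. k \<ge> 1 \<Longrightarrow> a (k + l) / (1 + a 1) ^ l \<le> d l k" by auto
    have mono1: "d l 1 / a 1 \<le> d l k / a k" if "k \<ge> 1" for k
      using that by (induction k rule: dec_induct) (auto intro: order_trans[OF _ mono])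
    have nn: "0 \<le> d l k" if "k \<ge> 1" for k
      using low[OF that] pos[of "k + l"] pos[of 1]
      by (smt (verit, best) divide_nonneg_pos zero_less_power)
    have br: "d l k / a k * (1 - c) \<le> d l k / a k - c * (d l 1 / a 1)" if "k \<ge> 1" for k
      using mult_left_mono[OF mono1[OF that] c(1)] by (simp only: right_diff_distrib mult_1_right) (simp only: mult.commute)
    have br0: "0 \<le> d l k / a k - c * (d l 1 / a 1)" if "k \<ge> 1" for k
      using br[OF that] nn[OF that] pos[of k] c by (smt (verit) divide_nonneg_pos mult_nonneg_nonneg)
    have "d (Suc l) k / a k \<le> d (Suc l) (Suc k) / a (Suc k)" if "k \<ge> 1" for k
      unfolding rec' c_def[symmetric]
      using mono[of "Suc k"] br0[of "Suc k"] pos[of "Suc k"] pos[of "Suc (Suc k)"]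
      by (intro mult_mono r_mono) auto
    moreover have "a (k + Suc l) / (1 + a 1) ^ Suc l \<le> d (Suc l) k" if "k \<ge> 1" for k
    proof -
      have "a (k + Suc l) / (1 + a 1) ^ Suc l = a (Suc k + l) / (1 + a 1) ^ l * (1 - c)"
        by (simp add: c)
      also have "\<dots> \<le> d l (Suc k) * (1 - c)"
        using low[of "Suc k"] c(2) by (intro mult_right_mono) auto
      also have "\<dots> = a (Suc k) * (d l (Suc k) / a (Suc k) * (1 - c))"
        using pos[of "Suc k"] by simp
      also have "\<dots> \<le> a (Suc k) * (d l (Suc k) / a (Suc k) - c * (d l 1 / a 1))"
        using br[of "Suc k"] pos[of "Suc k"] by (intro mult_left_mono) auto
      also have "\<dots> = a k * (d (Suc l) k / a k)"
        unfolding rec' c_def using pos[of k] by simp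
      also have "\<dots> = d (Suc l) k"
        using pos[of k] by simp
      finally show ?thesis .
    qed
    ultimately show ?case by blast
  qed
  then show "1 \<le> k \<Longrightarrow> a (k + l) / (1 + a 1) ^ l \<le> d l k" by blast
qed

text \<open>Exchanging one factor \<open>downdate Q v\<close> for \<open>Q\<close> leaves a rank-one
  term. Since \<open>downdate Q v v\<close> is a multiple of \<open>Q v\<close>, the trace of that
  term is exactly a mixed moment.\<close>

lemma trc_mixed_step:
  fixes Q :: "'b::euclidean_space \<Rightarrow> 'b"
  assumes sym: "\<And>x y. Q x \<bullet> y = x \<bullet> Q y" and lin: "linear Q" and nz: "1 + v \<bullet> Q v \<noteq> 0"
  shows "trc (\<lambda>x. (Q ^^ i) ((downdate Q v ^^ Suc j) x))
       = trc (\<lambda>x. (Q ^^ Suc i) ((downdate Q v ^^ j) x)) - v \<bullet> (Q ^^ Suc i) ((downdate Q v ^^ Suc j) v)"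
proof -
  let ?D = "downdate Q v"
  define c where "c = 1 / (1 + v \<bullet> Q v)"
  interpret linear "Q ^^ i" using linear_funpow[OF lin] .
  have Dv: "?D v = c *\<^sub>R Q v"
    using nz by (simp add: downdate_def c_def sym algebra_simps divide_simps flip: scaleR_left.add)
  have symD: "\<And>x y. (?D ^^ j) x \<bullet> y = x \<bullet> (?D ^^ j) y"
    by (rule selfadj_funpow) (rule selfadj_downdate[OF sym])
  have linD: "linear (?D ^^ j)"
    by (intro linear_funpow linear_downdate lin)
  have 1: "(Q ^^ i) ((?D ^^ Suc j) x) = (Q ^^ Suc i) ((?D ^^ j) x) - (x \<bullet> (?D ^^ Suc j) v) *\<^sub>R (Q ^^ Suc i) v" for x
  proof -
    have "(?D ^^ Suc j) x = Q ((?D ^^ j) x) - (x \<bullet> (?D ^^ j) (c *\<^sub>R Q v)) *\<^sub>R Q v"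
      using symD[of x "Q v"]
      by (simp add: downdate_def[of Q v "(downdate Q v ^^ j) x"] linear_scale[OF linD] c_def inner_commute)
    moreover have "(?D ^^ Suc j) v = (?D ^^ j) (c *\<^sub>R Q v)"
      by (simp add: funpow_swap1 Dv)
    ultimately show ?thesis
      by (simp only: diff scale funpow_Suc_right o_apply)
  qed
  have "trc (\<lambda>x. (Q ^^ i) ((?D ^^ Suc j) x))
     = trc (\<lambda>x. (Q ^^ Suc i) ((?D ^^ j) x)) - (\<Sum>b\<in>Basis. ((?D ^^ Suc j) v \<bullet> b) * ((Q ^^ Suc i) v \<bullet> b))"
    unfolding trc_def 1 by (simp add: inner_diff_right sum_subtractf inner_commute del: funpow.simps)
  also have "(\<Sum>b\<in>Basis. ((?D ^^ Suc j) v \<bullet> b) * ((Q ^^ Suc i) v \<bullet> b)) = v \<bullet> (Q ^^ Suc i) ((?D ^^ Suc j) v)"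
    unfolding euclidean_inner[symmetric]
    by (metis inner_commute selfadj_funpow[OF sym])
  finally show ?thesis .
qed

text \<open>Telescoping from \<open>Q ^^ p\<close> to \<open>downdate Q v ^^ p\<close>, one factor
  at a time. Each of the \<open>p\<close> exchanges subtracts a mixed moment, which the moment
  ratios bound from below.\<close>

lemma trc_downdate_funpow_le:
  fixes Q :: "'b::euclidean_space \<Rightarrow> 'b"
  assumes Q: "pd_op Q"
  shows "trc (downdate Q v ^^ p) \<le> trc (Q ^^ p) - real p * (v \<bullet> (Q ^^ Suc p) v) / (1 + v \<bullet> Q v) ^ p"
proof (cases "v = 0")
  case True
  have "downdate Q 0 = Q"
    using pd_op_eq_0_iff[OF Q, of 0] by (auto simp: downdate_def)
  then show ?thesis
    using True by simp
next
  case False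
  let ?D = "downdate Q v" and ?s = "v \<bullet> Q v"
  note sym = pd_opD(2)[OF Q] and lin = pd_opD(1)[OF Q]
  have s: "0 \<le> ?s" using pd_opD(4)[OF Q] .
  have mixed: "v \<bullet> (Q ^^ (k + l)) v / (1 + ?s) ^ l \<le> v \<bullet> (Q ^^ k) ((?D ^^ l) v)" if "1 \<le> k" for k l
    using moment_ratio_bound[where a="\<lambda>k. v \<bullet> (Q ^^ k) v" and d="\<lambda>l k. v \<bullet> (Q ^^ k) ((?D ^^ l) v)",
        OF pd_op_moment_pos[OF Q False] pd_op_moment_log_convex[OF Q] _ mixed_moment_recursion[OF sym lin] that]
    by simp
  have telescope: "j \<le> p \<Longrightarrow> trc (\<lambda>x. (Q ^^ (p - j)) ((?D ^^ j) x)) \<le> trc (Q ^^ p) - real j * (v \<bullet> (Q ^^ Suc p) v) / (1 + ?s) ^ p" for j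
  proof (induction j)
    case 0
    then show ?case by (simp add: id_def)
  next
    case (Suc j)
    then obtain i where i: "p - j = Suc i" "p - Suc j = i"
      by (metis Suc_diff_Suc Suc_le_eq)
    \<comment> \<open>The exponents of \<open>Q\<close> and of its downdate add up to
      \<open>Suc p\<close> in every exchange, so all losses share one lower bound.\<close>
    then have ij: "Suc i + Suc j = Suc p"
      using Suc by simp
    have "v \<bullet> (Q ^^ Suc p) v / (1 + ?s) ^ p \<le> v \<bullet> (Q ^^ Suc p) v / (1 + ?s) ^ Suc j"
      using s Suc.prems pd_opD(4)[OF pd_op_funpow[OF Q]]
      by (intro divide_left_mono power_increasing mult_pos_pos) (auto simp del: funpow.simps)
    also have "\<dots> \<le> v \<bullet> (Q ^^ Suc i) ((?D ^^ Suc j) v)"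
      using mixed[of "Suc i" "Suc j"] unfolding ij by simp
    finally show ?case
      using trc_mixed_step[OF sym lin, of v i j] s Suc i
      by (simp add: algebra_simps add_divide_distrib del: funpow.simps)
  qed
  show ?thesis
    using telescope[of p] by (simp add: id_def)
qed

section \<open>The resolvent of a frame operator\<close>

text \<open>The inverse of \<open>frame_op v k\<close>, built by recursion so that a further vector
  is one downdate by definition.\<close>

primrec resolvent :: "(nat \<Rightarrow> 'b::euclidean_space) \<Rightarrow> nat \<Rightarrow> 'b \<Rightarrow> 'b" where
  "resolvent v 0 = (\<lambda>x. x)"
| "resolvent v (Suc k) = downdate (resolvent v k) (v k)"

definition frame_op :: "(nat \<Rightarrow> 'b::euclidean_space) \<Rightarrow> nat \<Rightarrow> 'b \<Rightarrow> 'b" where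
  "frame_op v k x = x + (\<Sum>i<k. (v i \<bullet> x) *\<^sub>R v i)"

lemma inner_frame_op: "y \<bullet> frame_op v k x = y \<bullet> x + (\<Sum>i<k. (v i \<bullet> y) * (v i \<bullet> x))"
  by (simp add: frame_op_def inner_add_right inner_sum_right inner_commute mult.commute)

lemma inner_frame_op_self: "x \<bullet> frame_op v k x = (norm x)\<^sup>2 + (\<Sum>i<k. (v i \<bullet> x)\<^sup>2)"
  by (simp add: inner_frame_op power2_norm_eq_inner power2_eq_square[of "_ \<bullet> _"])

lemma norm_le_inner_frame_op: "(norm x)\<^sup>2 \<le> x \<bullet> frame_op v k x"
  by (simp add: inner_frame_op_self sum_nonneg)

lemma pd_op_frame_op: "pd_op (frame_op v k)"
proof (rule pd_opI)
  show "linear (frame_op v k)"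
    by (rule linearI) (simp_all add: frame_op_def inner_add_right scaleR_add_left sum.distrib scaleR_sum_right scaleR_add_right)
  show "frame_op v k x \<bullet> y = x \<bullet> frame_op v k y" for x y
    by (subst inner_commute) (simp add: inner_frame_op inner_commute mult.commute)
  show "0 < x \<bullet> frame_op v k x" if "x \<noteq> 0" for x
    using norm_le_inner_frame_op[of x v k] that by (smt (verit) zero_less_norm_iff zero_less_power)
qed

text \<open>The two facts support each other: definiteness keeps the Sherman-Morrison denominator
  positive, and the inverse property yields definiteness, since \<open>y = resolvent v k x\<close>
  satisfies \<open>x \<bullet> y = y \<bullet> frame_op v k y\<close>.\<close>

lemma resolvent_properties: "pd_op (resolvent v k) \<and> (\<forall>x. frame_op v k (resolvent v k x) = x)"
proof (induction k)
  case 0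
  then show ?case by (simp add: pd_op_def linear_id[unfolded id_def] frame_op_def)
next
  case (Suc k)
  let ?Q = "resolvent v k" and ?v = "v k"
  have Q: "pd_op ?Q" and inv: "\<And>x. frame_op v k (?Q x) = x"
    using Suc by auto
  define c where "c = 1 / (1 + ?v \<bullet> ?Q ?v)"
  have c: "c * (?v \<bullet> ?Q ?v) = 1 - c"
    using pd_opD(4)[OF Q, of ?v] by (simp add: c_def field_simps)
  have inv': "frame_op v (Suc k) (resolvent v (Suc k) x) = x" for x
  proof -
    let ?y = "downdate ?Q ?v x" and ?r = "?Q ?v \<bullet> x"
    have y: "?y = ?Q x - (c * ?r) *\<^sub>R ?Q ?v"
      by (simp add: downdate_def c_def)
    have "frame_op v (Suc k) ?y = frame_op v k ?y + (?v \<bullet> ?y) *\<^sub>R ?v"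
      by (simp add: frame_op_def add.assoc)
    also have "frame_op v k ?y = x - (c * ?r) *\<^sub>R ?v"
      unfolding y by (simp add: linear_diff linear_scale pd_opD(1)[OF pd_op_frame_op] inv)
    also have "?v \<bullet> ?y = c * ?r"
    proof -
      have "?v \<bullet> ?y = ?r - ?r * (c * (?v \<bullet> ?Q ?v))"
        by (simp add: y inner_diff_right pd_opD(2)[OF Q])
      then show ?thesis
        by (simp only: c) (simp add: algebra_simps)
    qed
    finally show ?thesis by simp
  qed
  moreover have "pd_op (resolvent v (Suc k))"
  proof (rule pd_opI)
    show "linear (resolvent v (Suc k))"
      by (simp add: linear_downdate pd_opD(1)[OF Q])
    show sym: "resolvent v (Suc k) x \<bullet> y = x \<bullet> resolvent v (Suc k) y" for x y
      by (simp add: selfadj_downdate pd_opD(2)[OF Q])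
    show "0 < x \<bullet> resolvent v (Suc k) x" if "x \<noteq> 0" for x
    proof -
      let ?y = "resolvent v (Suc k) x"
      have "?y \<noteq> 0"
        using inv'[of x] that pd_op_eq_0_iff[OF pd_op_frame_op] by metis
      then have "0 < ?y \<bullet> frame_op v (Suc k) ?y"
        by (rule pd_opD(3)[OF pd_op_frame_op])
      then show ?thesis
        unfolding inv' by (simp add: inner_commute)
    qed
  qed
  ultimately show ?case by blast
qed

lemma pd_op_resolvent: "pd_op (resolvent v k)"
  and frame_op_resolvent: "frame_op v k (resolvent v k x) = x"
  using resolvent_properties by auto

lemma inner_resolvent_eq: "x \<bullet> resolvent v k x = resolvent v k x \<bullet> frame_op v k (resolvent v k x)"
  by (simp add: frame_op_resolvent inner_commute)

text \<open>The frame operator dominates the identity, so its inverse is dominated by the identity;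
  Cauchy-Schwarz replaces diagonalization.\<close>

lemma inner_resolvent_le: "x \<bullet> resolvent v k x \<le> (norm x)\<^sup>2"
proof -
  let ?y = "resolvent v k x" and ?z = "x \<bullet> resolvent v k x"
  have z: "0 \<le> ?z" by (rule pd_opD(4)[OF pd_op_resolvent])
  have "?z\<^sup>2 \<le> (norm x * norm ?y)\<^sup>2"
    using Cauchy_Schwarz_ineq2[of x ?y] abs_le_square_iff[of ?z "norm x * norm ?y"] by (simp add: abs_mult)
  also have "\<dots> \<le> (norm x)\<^sup>2 * ?z"
    using norm_le_inner_frame_op[of ?y v k] inner_resolvent_eq[of x v k]
    by (simp add: power_mult_distrib mult_left_mono)
  finally show ?thesis
    using z by (cases "?z = 0") (auto simp: power2_eq_square)
qed

text \<open>The frame operator is at most this constant times the identity. Cauchy-Schwarz for the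
  frame form, applied to \<open>x\<close> and \<open>resolvent v k x\<close>, passes to the
  inverse.\<close>

lemma norm_le_inner_resolvent: "(norm x)\<^sup>2 \<le> (1 + (\<Sum>i<k. (norm (v i))\<^sup>2)) * (x \<bullet> resolvent v k x)"
proof -
  let ?A = "frame_op v k" and ?y = "resolvent v k x"
  let ?K = "1 + (\<Sum>i<k. (norm (v i))\<^sup>2)"
  have "x \<bullet> ?A x \<le> ?K * (norm x)\<^sup>2"
    unfolding inner_frame_op_self distrib_right sum_distrib_right
    by (intro add_mono sum_mono) (auto simp: power_mult_distrib[symmetric] abs_le_square_iff[symmetric] abs_mult Cauchy_Schwarz_ineq2)
  moreover have "(x \<bullet> ?A ?y)\<^sup>2 \<le> (x \<bullet> ?A x) * (?y \<bullet> ?A ?y)"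
    by (rule pd_op_Cauchy_Schwarz[OF pd_op_frame_op])
  ultimately have "((norm x)\<^sup>2)\<^sup>2 \<le> ?K * (norm x)\<^sup>2 * (x \<bullet> ?y)"
    using pd_opD(4)[OF pd_op_resolvent, of x v k]
    by (smt (verit) frame_op_resolvent inner_commute mult_right_mono power2_norm_eq_inner)
  then show ?thesis
    by (cases "x = 0") (auto simp: power2_eq_square)
qed

text \<open>Jensen's inequality for the spectral measure of \<open>x\<close>, read off from
  log-convexity: the ratios of successive moments increase, and the first one is
  \<open>x \<bullet> Q x\<close>.\<close>

lemma pd_op_moment_ge_power:
  assumes "pd_op Q" "norm x = 1"
  shows "(x \<bullet> Q x) ^ k \<le> x \<bullet> (Q ^^ k) x"
proof -
  let ?b = "\<lambda>k. x \<bullet> (Q ^^ k) x"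
  have x: "x \<noteq> 0" using assms by auto
  note pos = pd_op_moment_pos[OF assms(1) x]
  have ratio: "?b 1 * ?b k \<le> ?b (Suc k)" for k
  proof (induction k)
    case 0
    then show ?case using assms(2) by (simp add: power2_norm_eq_inner[symmetric])
  next
    case (Suc k)
    have "?b 1 * ?b k * ?b (Suc k) \<le> (?b (Suc k))\<^sup>2"
      using mult_right_mono[OF Suc less_imp_le[OF pos[of "Suc k"]]] by (simp add: power2_eq_square)
    also have "\<dots> \<le> ?b k * ?b (Suc (Suc k))"
      by (rule pd_op_moment_log_convex[OF assms(1)])
    finally have "?b k * (?b 1 * ?b (Suc k)) \<le> ?b k * ?b (Suc (Suc k))"
      by (simp only: mult_ac)
    then show ?case
      using pos[of k] by (simp only: mult_le_cancel_left_pos)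
  qed
  show ?thesis
  proof (induction k)
    case 0
    then show ?case using assms(2) by (simp add: power2_norm_eq_inner[symmetric])
  next
    case (Suc k)
    have "(x \<bullet> Q x) ^ Suc k \<le> ?b 1 * ?b k"
      using mult_left_mono[OF Suc, of "x \<bullet> Q x"] pd_opD(4)[OF assms(1), of x] by simp
    then show ?case using ratio[of k] by linarith
  qed
qed

text \<open>Even exponents exhibit the trace as a sum of squares, which is why the potential below
  uses \<open>p = 2 * q\<close>.\<close>

lemma trc_double_power:
  assumes "\<And>x y. Q x \<bullet> y = x \<bullet> Q y"
  shows "trc (Q ^^ (2 * q)) = (\<Sum>b\<in>Basis. (norm ((Q ^^ q) b))\<^sup>2)"
  by (simp add: trc_def mult_2 funpow_add power2_norm_eq_inner selfadj_funpow[OF assms])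

text \<open>With \<open>R = Q ^^ q\<close> the left side is the squared norm of \<open>R x\<close>,
  at most the squared Hilbert-Schmidt norm of \<open>R\<close>.\<close>

lemma moment_le_trc:
  assumes "pd_op Q" "norm x = 1"
  shows "x \<bullet> (Q ^^ (2 * q)) x \<le> trc (Q ^^ (2 * q))"
proof -
  let ?R = "Q ^^ q"
  note sym = selfadj_funpow[OF pd_opD(2)[OF assms(1)]]
  have "x \<bullet> (Q ^^ (2 * q)) x = ?R x \<bullet> ?R x"
    by (simp add: mult_2 funpow_add sym)
  also have "\<dots> = (\<Sum>b\<in>Basis. (?R b \<bullet> x)\<^sup>2)"
    by (subst euclidean_inner) (simp add: power2_eq_square, simp add: sym inner_commute[of x])
  also have "\<dots> \<le> (\<Sum>b\<in>Basis. (norm (?R b))\<^sup>2)"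
    using Cauchy_Schwarz_ineq2[of "?R _" x] assms(2)
    by (intro sum_mono) (simp add: abs_le_square_iff[symmetric])
  finally show ?thesis
    by (simp add: trc_double_power[OF pd_opD(2)[OF assms(1)]])
qed

text \<open>A direction of small energy makes the inverse large there: Cauchy-Schwarz gives at least
  \<open>1 / (1 + s)\<close>. Contrapositively, a small trace bounds the energy from below in every
  direction.\<close>

lemma trc_resolvent_ge:
  assumes x: "norm x = 1" and s: "(\<Sum>i<k. (v i \<bullet> x)\<^sup>2) \<le> s"
  shows "1 / (1 + s) ^ (2 * q) \<le> trc (resolvent v k ^^ (2 * q))"
proof -
  let ?Q = "resolvent v k" and ?A = "frame_op v k"
  have s0: "0 \<le> s"
    using s by (smt (verit) sum_nonneg zero_le_power2)
  have "(x \<bullet> ?A (?Q x))\<^sup>2 \<le> (x \<bullet> ?A x) * (?Q x \<bullet> ?A (?Q x))"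
    by (rule pd_op_Cauchy_Schwarz[OF pd_op_frame_op])
  then have "1 \<le> (x \<bullet> ?A x) * (x \<bullet> ?Q x)"
    using x by (simp add: frame_op_resolvent inner_commute flip: power2_norm_eq_inner)
  also have "\<dots> \<le> (1 + s) * (x \<bullet> ?Q x)"
    using s x by (intro mult_right_mono pd_opD(4)[OF pd_op_resolvent]) (simp add: inner_frame_op_self)
  finally have "1 / (1 + s) \<le> x \<bullet> ?Q x"
    using s0 by (simp add: field_simps)
  then have "(1 / (1 + s)) ^ (2 * q) \<le> (x \<bullet> ?Q x) ^ (2 * q)"
    using s0 by (intro power_mono) auto
  also have "\<dots> \<le> x \<bullet> (?Q ^^ (2 * q)) x"
    by (rule pd_op_moment_ge_power[OF pd_op_resolvent x])
  also have "\<dots> \<le> trc (?Q ^^ (2 * q))"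
    by (rule moment_le_trc[OF pd_op_resolvent x])
  finally show ?thesis by (simp add: power_one_over)
qed

section \<open>Lower tail of the empirical second moment\<close>

text \<open>The supermartingale argument in product form: by Fubini the last sample is integrated
  out at the cost of a factor \<open>\<rho>\<close>. With Markov's inequality this yields every tail
  bound below.\<close>

lemma nn_integral_PiM_potential_le:
  fixes F :: "nat \<Rightarrow> (nat \<Rightarrow> 'a) \<Rightarrow> ennreal"
  assumes "prob_space M"
    and meas: "\<And>k. k \<le> n \<Longrightarrow> F k \<in> borel_measurable (PiM {..<k} (\<lambda>_. M))"
    and step: "\<And>k X. k < n \<Longrightarrow> X \<in> space (PiM {..<k} (\<lambda>_. M)) \<Longrightarrow>
                 (\<integral>\<^sup>+ y. F (Suc k) (X(k := y)) \<partial>M) \<le> \<rho> * F k X"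
    and init: "\<And>X. F 0 X = c"
  shows "(\<integral>\<^sup>+ X. F n X \<partial>PiM {..<n} (\<lambda>_. M)) \<le> \<rho> ^ n * c"
proof -
  interpret prob_space M by fact
  interpret product_sigma_finite "\<lambda>_::nat. M"
    by (simp add: product_sigma_finite_def sigma_finite_measure_axioms)
  have "k \<le> n \<Longrightarrow> (\<integral>\<^sup>+ X. F k X \<partial>PiM {..<k} (\<lambda>_. M)) \<le> \<rho> ^ k * c" for k
  proof (induction k)
    case 0
    then show ?case by (simp add: init emeasure_PiM_empty space_PiM_empty)
  next
    case (Suc k)
    have "(\<integral>\<^sup>+ X. F (Suc k) X \<partial>PiM {..<Suc k} (\<lambda>_. M))
        = (\<integral>\<^sup>+ X. (\<integral>\<^sup>+ y. F (Suc k) (X(k := y)) \<partial>M) \<partial>PiM {..<k} (\<lambda>_. M))"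
      using meas[OF Suc.prems] unfolding lessThan_Suc by (intro product_nn_integral_insert) auto
    also have "\<dots> \<le> (\<integral>\<^sup>+ X. \<rho> * F k X \<partial>PiM {..<k} (\<lambda>_. M))"
      using Suc.prems by (intro nn_integral_mono step) auto
    also have "\<dots> = \<rho> * (\<integral>\<^sup>+ X. F k X \<partial>PiM {..<k} (\<lambda>_. M))"
      using Suc.prems by (intro nn_integral_cmult meas) auto
    also have "\<dots> \<le> \<rho> * (\<rho> ^ k * c)"
      using Suc by (intro mult_left_mono) auto
    finally show ?case by (simp add: mult.assoc)
  qed
  then show ?thesis by blast
qed

section \<open>Measurability of the trace potential\<close>

lemma resolvent_cong: "(\<And>i. i < k \<Longrightarrow> v i = w i) \<Longrightarrow> resolvent v k = resolvent w k"
  by (induction k) auto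

lemma borel_measurable_resolvent [measurable (raw)]:
  assumes "\<And>i. i < k \<Longrightarrow> (\<lambda>X. v X i) \<in> borel_measurable N" "w \<in> borel_measurable N"
  shows "(\<lambda>X. resolvent (v X) k (w X)) \<in> borel_measurable N"
  using assms
proof (induction k arbitrary: w)
  case (Suc k)
  have [measurable]: "(\<lambda>X. v X k) \<in> borel_measurable N" "w \<in> borel_measurable N"
    using Suc.prems by auto
  have [measurable]: "(\<lambda>X. resolvent (v X) k (w' X)) \<in> borel_measurable N"
    if "w' \<in> borel_measurable N" for w'
    using Suc.prems that by (intro Suc.IH) auto
  show ?case
    by (simp add: downdate_def)
qed auto

lemma borel_measurable_resolvent_funpow:
  assumes "\<And>i. i < k \<Longrightarrow> (\<lambda>X. v X i) \<in> borel_measurable N" "w \<in> borel_measurable N"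
  shows "(\<lambda>X. (resolvent (v X) k ^^ j) (w X)) \<in> borel_measurable N"
  using assms by (induction j) (auto intro: borel_measurable_resolvent)

lemma borel_measurable_trc_resolvent:
  fixes v :: "'c \<Rightarrow> nat \<Rightarrow> 'b::euclidean_space"
  assumes "\<And>i. i < k \<Longrightarrow> (\<lambda>X. v X i) \<in> borel_measurable N"
  shows "(\<lambda>X. trc (resolvent (v X) k ^^ j)) \<in> borel_measurable N"
  unfolding trc_def
  by (intro borel_measurable_sum borel_measurable_inner borel_measurable_const
      borel_measurable_resolvent_funpow assms)

lemma (in prob_space) prob_less_ge_Markov:
  fixes g :: "'a \<Rightarrow> ennreal"
  assumes [measurable]: "g \<in> borel_measurable M"
    and le: "(\<integral>\<^sup>+ x. g x \<partial>M) \<le> ennreal K" and K: "0 \<le> K" and t: "0 < t"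
  shows "1 - K / t \<le> prob {x \<in> space M. g x < ennreal t}"
proof -
  have eq: "{x \<in> space M. \<not> g x < ennreal t} = {x \<in> space M. 1 \<le> ennreal (1 / t) * g x}"
  proof -
    have "ennreal t \<le> g x \<longleftrightarrow> 1 \<le> ennreal (1 / t) * g x" for x
    proof (cases "g x" rule: ennreal_cases)
      case (real r)
      then show ?thesis
        using t by (simp add: ennreal_mult[symmetric] ennreal_1[symmetric] field_simps del: ennreal_1)
    next
      case top
      then show ?thesis using t by (simp add: ennreal_mult_top)
    qed
    then show ?thesis by (auto simp: not_less)
  qed
  have "emeasure M {x \<in> space M. \<not> g x < ennreal t} \<le> ennreal (1 / t) * (\<integral>\<^sup>+ x. g x * indicator (space M) x \<partial>M)"
    unfolding eq by (rule nn_integral_Markov_inequality) auto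
  also have "(\<integral>\<^sup>+ x. g x * indicator (space M) x \<partial>M) = (\<integral>\<^sup>+ x. g x \<partial>M)"
    by (intro nn_integral_cong) auto
  also have "ennreal (1 / t) * (\<integral>\<^sup>+ x. g x \<partial>M) \<le> ennreal (1 / t) * ennreal K"
    by (intro mult_left_mono le) auto
  also have "\<dots> = ennreal (K / t)"
    using t K by (simp add: ennreal_mult[symmetric])
  finally have "prob {x \<in> space M. \<not> g x < ennreal t} \<le> K / t"
    using t K by (simp add: emeasure_eq_measure)
  moreover have "prob {x \<in> space M. \<not> g x < ennreal t} = 1 - prob {x \<in> space M. g x < ennreal t}"
    by (intro prob_neg) auto
  ultimately show ?thesis by simp
qed

lemma integrable_inner_product_bounded:
  fixes u :: "'a \<Rightarrow> 'b::euclidean_space"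
  assumes "prob_space M" and [measurable]: "u \<in> borel_measurable M"
    and "\<And>y. y \<in> space M \<Longrightarrow> (norm (u y))\<^sup>2 \<le> B"
  shows "integrable M (\<lambda>z. (u z \<bullet> x) * (u z \<bullet> y))"
proof -
  interpret prob_space M by fact
  show ?thesis
  proof (rule integrable_const_bound[where B = "B * (norm x * norm y)"])
    have "\<bar>u z \<bullet> x\<bar> * \<bar>u z \<bullet> y\<bar> \<le> (norm (u z))\<^sup>2 * (norm x * norm y)" for z
      using mult_mono[OF Cauchy_Schwarz_ineq2[of "u z" x] Cauchy_Schwarz_ineq2[of "u z" y]]
      by (simp add: power2_eq_square mult_ac)
    then show "AE z in M. norm ((u z \<bullet> x) * (u z \<bullet> y)) \<le> B * (norm x * norm y)"
      using mult_right_mono[OF assms(3), of _ "norm x * norm y"]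
      by (intro AE_I2) (auto simp: abs_mult intro: order_trans)
  qed measurable
qed

text \<open>Averaging over an isotropic \<open>v\<close> turns the moment in the rank-one estimate
  into \<open>\<kappa> * trc (Q ^^ Suc p)\<close>, at least \<open>\<kappa> * 10 / 11\<close> times
  the trace of \<open>Q ^^ p\<close>. The denominator is at most
  \<open>(1 + 1 / p) ^ p \<le> 3\<close>. Together they give the 10/33.\<close>

lemma nn_integral_trc_downdate_le:
  fixes v :: "'a \<Rightarrow> 'b::euclidean_space"
  assumes M: "prob_space M" and [measurable]: "v \<in> borel_measurable M"
    and Q: "pd_op Q" "\<And>w. w \<bullet> Q w \<le> (norm w)\<^sup>2" "\<And>w. (norm w)\<^sup>2 \<le> 11 / 10 * (w \<bullet> Q w)"
    and p: "p = 2 * q" "0 < p"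
    and v: "\<And>y. y \<in> space M \<Longrightarrow> (norm (v y))\<^sup>2 \<le> 1 / real p"
    and cov: "\<And>x y. (\<integral> z. (v z \<bullet> x) * (v z \<bullet> y) \<partial>M) = \<kappa> * (x \<bullet> y)" and \<kappa>: "0 \<le> \<kappa>"
  shows "(\<integral>\<^sup>+ y. ennreal (trc (downdate Q (v y) ^^ p)) \<partial>M) \<le> ennreal (1 - 10 * \<kappa> * p / 33) * ennreal (trc (Q ^^ p))"
proof -
  interpret prob_space M by fact
  let ?N = "Q ^^ Suc p"
  note symQ = pd_opD(2)[OF Q(1)]
  note sym = selfadj_funpow[OF symQ]
  have pd: "pd_op ?N" by (rule pd_op_funpow[OF Q(1)])
  note int = integrable_inner_product_bounded[OF M assms(2) v]
  have moment: "v y \<bullet> ?N (v y) = (\<Sum>b\<in>Basis. (v y \<bullet> b) * (v y \<bullet> ?N b))" for y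
    by (subst euclidean_inner) (simp only: sym)
  have int_moment: "integrable M (\<lambda>y. v y \<bullet> ?N (v y))"
    unfolding moment by (intro Bochner_Integration.integrable_sum int)
  have "(\<integral> y. v y \<bullet> ?N (v y) \<partial>M) = \<kappa> * trc ?N"
    unfolding moment by (subst Bochner_Integration.integral_sum) (auto simp: int cov trc_def sum_distrib_left simp del: funpow.simps)
  also have "\<dots> \<ge> \<kappa> * (10 / 11 * trc (Q ^^ p))"
  proof (intro mult_left_mono \<kappa>)
    have "trc ?N = (\<Sum>b\<in>Basis. (Q ^^ q) b \<bullet> Q ((Q ^^ q) b))"
      by (simp add: trc_def p mult_2 funpow_add sym symQ funpow_swap1)
    moreover have "10 / 11 * (norm ((Q ^^ q) b))\<^sup>2 \<le> (Q ^^ q) b \<bullet> Q ((Q ^^ q) b)" for b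
      using Q(3)[of "(Q ^^ q) b"] by simp
    ultimately show "10 / 11 * trc (Q ^^ p) \<le> trc ?N"
      by (simp add: p(1) trc_double_power[OF symQ] sum_distrib_left sum_mono del: funpow.simps)
  qed
  finally have lower: "\<kappa> * (10 / 11 * trc (Q ^^ p)) \<le> (\<integral> y. v y \<bullet> ?N (v y) \<partial>M)" .
  have pt: "trc (downdate Q (v y) ^^ p) \<le> trc (Q ^^ p) - real p / 3 * (v y \<bullet> ?N (v y))" if "y \<in> space M" for y
  proof -
    let ?s = "v y \<bullet> Q (v y)"
    have s: "0 \<le> ?s" "?s \<le> 1 / real p"
      using pd_opD(4)[OF Q(1)] order_trans[OF Q(2) v[OF that]] by auto
    have "(1 + ?s) ^ p \<le> exp (1 / real p) ^ p"
      using s exp_ge_add_one_self[of "1 / real p"] by (intro power_mono) linarith+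
    also have "\<dots> = exp 1"
      using p(2) by (simp flip: exp_of_nat_mult)
    also have "\<dots> \<le> 3" by (rule exp_le)
    finally have "real p * (v y \<bullet> ?N (v y)) / 3 \<le> real p * (v y \<bullet> ?N (v y)) / (1 + ?s) ^ p"
      using s pd_opD(4)[OF pd] by (intro divide_left_mono mult_nonneg_nonneg mult_pos_pos) auto
    moreover have "real p * (v y \<bullet> ?N (v y)) / 3 = real p / 3 * (v y \<bullet> ?N (v y))"
      by simp
    ultimately show ?thesis
      using trc_downdate_funpow_le[OF Q(1), where v = "v y" and p = p] by linarith
  qed
  have nonneg: "0 \<le> trc (downdate Q w ^^ p)" "0 \<le> trc (Q ^^ p)" for w
    by (simp_all add: p(1) trc_double_power selfadj_downdate symQ sum_nonneg)
  have "(\<integral>\<^sup>+ y. ennreal (trc (downdate Q (v y) ^^ p)) \<partial>M)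
      \<le> (\<integral>\<^sup>+ y. ennreal (trc (Q ^^ p) - real p / 3 * (v y \<bullet> ?N (v y))) \<partial>M)"
    by (intro nn_integral_mono ennreal_leI pt)
  also have "\<dots> = ennreal (\<integral> y. trc (Q ^^ p) - real p / 3 * (v y \<bullet> ?N (v y)) \<partial>M)"
    using int_moment order_trans[OF nonneg(1) pt]
    by (intro nn_integral_eq_integral AE_I2) auto
  also have "(\<integral> y. trc (Q ^^ p) - real p / 3 * (v y \<bullet> ?N (v y)) \<partial>M) = trc (Q ^^ p) - real p / 3 * (\<integral> y. v y \<bullet> ?N (v y) \<partial>M)"
    using int_moment by (simp add: prob_space del: funpow.simps)
  also have "\<dots> \<le> (1 - 10 * \<kappa> * p / 33) * trc (Q ^^ p)"
    using mult_left_mono[OF lower, of "real p / 3"] by (simp add: algebra_simps del: funpow.simps)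
  finally show ?thesis
    using nonneg(2) by (simp add: ennreal_leI ennreal_mult'')
qed

text \<open>A unit vector with energy at most \<open>6 / 25 * n\<close> would force the potential to
  be at least \<open>exp (- 6 * n / (25 * B))\<close>, while its mean is at most
  \<open>DIM('b) * exp (- 10 * n / (33 * B))\<close>. Markov's inequality then suffices because
  \<open>10 / 33 - 6 / 25 > 1 / 18\<close>.\<close>

lemma second_moment_lower_tail:
  fixes u :: "'a \<Rightarrow> 'b::euclidean_space" and n :: nat
  assumes M: "prob_space M" and [measurable]: "u \<in> borel_measurable M"
    and B: "0 < B" "\<And>y. y \<in> space M \<Longrightarrow> (norm (u y))\<^sup>2 \<le> B"
    and cov: "\<And>x y. (\<integral> z. (u z \<bullet> x) * (u z \<bullet> y) \<partial>M) = x \<bullet> y" and n: "0 < n"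
  shows "\<exists>E \<in> sets (PiM {..<n} (\<lambda>_. M)). 1 - DIM('b) * exp (- real n / (18 * B)) \<le> measure (PiM {..<n} (\<lambda>_. M)) E \<and>
           (\<forall>X\<in>E. \<forall>x. 6 / 25 * n * (norm x)\<^sup>2 \<le> (\<Sum>i<n. (u (X i) \<bullet> x)\<^sup>2))"
proof -
  interpret prob_space M by fact
  interpret PP: prob_space "PiM {..<n} (\<lambda>_. M)"
    by (intro prob_space_PiM M)
  \<comment> \<open>The exponent \<open>p = 10 * n\<close> is even, and so large that the squared
    norms of the scaled vectors sum to at most \<open>1 / 10\<close>; hence the resolvents stay
    above 10/11 of the identity.\<close>
  define q where "q = 5 * n"
  define p where "p = 2 * q"
  have p: "0 < p" "real p = 10 * real n"
    using n by (auto simp: p_def q_def)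
  \<comment> \<open>Scaled to squared norm at most \<open>1 / p\<close>; the second moment becomes
    \<open>1 / (B * p)\<close> times the identity.\<close>
  define v where "v y = (1 / sqrt (B * p)) *\<^sub>R u y" for y
  have [measurable]: "v \<in> borel_measurable M"
    unfolding v_def by measurable
  have Bp: "0 < B * p" using B p by simp
  have v_inner: "(v z \<bullet> x) * (v z \<bullet> y) = 1 / (B * p) * ((u z \<bullet> x) * (u z \<bullet> y))" for x y z
    using Bp by (simp add: v_def)
  have v_norm: "(norm (v y))\<^sup>2 \<le> 1 / real p" if "y \<in> space M" for y
    using B(2)[OF that] B(1) p Bp by (simp add: v_def power_divide divide_simps)
  let ?R = "\<lambda>X k. resolvent (\<lambda>i. v (X i)) k :: 'b \<Rightarrow> 'b"
  let ?F = "\<lambda>k X. ennreal (trc (?R X k ^^ p))"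
  let ?\<rho> = "exp (- 10 / (33 * B))"
  have meas: "?F k \<in> borel_measurable (PiM {..<k} (\<lambda>_. M))" for k
    by (intro measurable_compose[OF _ measurable_ennreal] borel_measurable_trc_resolvent) measurable
  have "(\<integral>\<^sup>+ X. ?F n X \<partial>PiM {..<n} (\<lambda>_. M)) \<le> ennreal ?\<rho> ^ n * ennreal (real DIM('b))"
  proof (rule nn_integral_PiM_potential_le[OF M meas])
    fix k X assume k: "k < n" and X: "X \<in> space (PiM {..<k} (\<lambda>_. M))"
    have "resolvent (\<lambda>i. v ((X(k := y)) i)) k = ?R X k" for y
      by (rule resolvent_cong) auto
    then have "(\<integral>\<^sup>+ y. ?F (Suc k) (X(k := y)) \<partial>M) = (\<integral>\<^sup>+ y. ennreal (trc (downdate (?R X k) (v y) ^^ p)) \<partial>M)"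
      by simp
    also have "\<dots> \<le> ennreal (1 - 10 * (1 / (B * p)) * p / 33) * ennreal (trc (?R X k ^^ p))"
    proof (rule nn_integral_trc_downdate_le[OF M _ pd_op_resolvent inner_resolvent_le _ p_def p(1) v_norm])
      fix w :: 'b
      have "(\<Sum>i<k. (norm (v (X i)))\<^sup>2) \<le> (\<Sum>i<k. 1 / real p)"
        using X by (intro sum_mono v_norm) (auto simp: space_PiM)
      also have "\<dots> \<le> 1 / 10"
        using k p by (simp add: field_simps)
      finally have "1 + (\<Sum>i<k. (norm (v (X i)))\<^sup>2) \<le> 11 / 10" by simp
      then show "(norm w)\<^sup>2 \<le> 11 / 10 * (w \<bullet> ?R X k w)"
        using norm_le_inner_resolvent[of w "\<lambda>i. v (X i)" k] pd_opD(4)[OF pd_op_resolvent, of w "\<lambda>i. v (X i)" k]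
        by (meson mult_right_mono order_trans)
    qed (use B p cov in \<open>auto simp: v_inner\<close>)
    also have "\<dots> \<le> ennreal ?\<rho> * ennreal (trc (?R X k ^^ p))"
      using B p exp_ge_add_one_self[of "- 10 / (33 * B)"]
      by (intro mult_right_mono ennreal_leI) (auto simp: field_simps)
    finally show "(\<integral>\<^sup>+ y. ?F (Suc k) (X(k := y)) \<partial>M) \<le> ennreal ?\<rho> * ?F k X" .
  next
    have "((\<lambda>x::'b. x) ^^ p) = (\<lambda>x. x)" for p :: nat by (induction p) auto
    then show "ennreal (trc (?R X 0 ^^ p)) = ennreal (real DIM('b))" for X
      by (simp add: trc_def)
  qed
  also have "\<dots> = ennreal (?\<rho> ^ n * real DIM('b))"
    by (simp add: ennreal_power ennreal_mult)
  finally have "1 - ?\<rho> ^ n * real DIM('b) / exp (- 6 * n / (25 * B)) \<le> PP.prob {X \<in> space (PiM {..<n} (\<lambda>_. M)). ?F n X < ennreal (exp (- 6 * n / (25 * B)))}"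
    by (intro PP.prob_less_ge_Markov meas) auto
  moreover have "?\<rho> ^ n * real DIM('b) / exp (- 6 * n / (25 * B)) \<le> DIM('b) * exp (- real n / (18 * B))"
  proof -
    have "?\<rho> ^ n / exp (- 6 * n / (25 * B)) = exp (n * (- 10 / (33 * B)) - (- 6 * n / (25 * B)))"
      by (simp only: exp_diff exp_of_nat_mult)
    also have "\<dots> \<le> exp (- real n / (18 * B))"
      using B by (simp add: field_simps)
    finally show ?thesis
      by (simp add: field_simps)
  qed
  moreover have "6 / 25 * n * (norm x)\<^sup>2 \<le> (\<Sum>i<n. (u (X i) \<bullet> x)\<^sup>2)"
    if X: "?F n X < ennreal (exp (- 6 * n / (25 * B)))" for X x
  proof (cases "x = 0")
    case False
    define y where "y = (1 / norm x) *\<^sub>R x"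
    have y: "norm y = 1" "x = norm x *\<^sub>R y"
      using False by (auto simp: y_def)
    have "6 / 25 * n < (\<Sum>i<n. (u (X i) \<bullet> y)\<^sup>2)"
    proof (rule ccontr)
      assume "\<not> ?thesis"
      then have "(\<Sum>i<n. (v (X i) \<bullet> y)\<^sup>2) \<le> 1 / (B * p) * (6 / 25 * n)"
        unfolding power2_eq_square v_inner sum_distrib_left[symmetric]
        using Bp by (intro mult_left_mono) (auto simp: power2_eq_square)
      then have "1 / (1 + 1 / (B * p) * (6 / 25 * n)) ^ p \<le> trc (?R X n ^^ p)"
        unfolding p_def by (rule trc_resolvent_ge[OF y(1)])
      moreover have "exp (- 6 * n / (25 * B)) \<le> 1 / (1 + 1 / (B * p) * (6 / 25 * n)) ^ p"
      proof -
        have "(1 + 1 / (B * p) * (6 / 25 * n)) ^ p \<le> exp (1 / (B * p) * (6 / 25 * n)) ^ p"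
          using Bp by (intro power_mono exp_ge_add_one_self) (auto intro!: add_nonneg_nonneg)
        also have "\<dots> = exp (6 * n / (25 * B))"
          using p B by (simp add: field_simps flip: exp_of_nat_mult)
        finally show ?thesis
          using Bp by (simp add: exp_minus field_simps add_pos_nonneg)
      qed
      ultimately have "exp (- 6 * n / (25 * B)) \<le> trc (?R X n ^^ p)"
        by linarith
      then show False
        using X ennreal_leI not_less by blast
    qed
    from mult_left_mono[OF less_imp_le[OF this], of "(norm x)\<^sup>2"]
    have "6 / 25 * n * (norm x)\<^sup>2 \<le> (norm x)\<^sup>2 * (\<Sum>i<n. (u (X i) \<bullet> y)\<^sup>2)"
      by (simp add: mult_ac)
    also have "\<dots> = (\<Sum>i<n. (u (X i) \<bullet> x)\<^sup>2)"
      by (subst (2) y(2)) (simp add: sum_distrib_left power_mult_distrib)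
    finally show ?thesis .
  qed auto
  moreover have "{X \<in> space (PiM {..<n} (\<lambda>_. M)). ?F n X < ennreal (exp (- 6 * n / (25 * B)))} \<in> sets (PiM {..<n} (\<lambda>_. M))"
    using meas[of n] by measurable
  ultimately show ?thesis
    by (intro bexI[of _ "{X \<in> space (PiM {..<n} (\<lambda>_. M)). ?F n X < ennreal (exp (- 6 * n / (25 * B)))}"]) auto
qed

section \<open>Tails of sums of random vectors\<close>

lemma power_convex_combination_le:
  fixes a b l :: real
  assumes "0 \<le> l" "l \<le> 1" "0 \<le> a" "0 \<le> b"
  shows "((1 - l) * a + l * b) ^ k \<le> (1 - l) * a ^ k + l * b ^ k"
proof (induction k)
  case (Suc k)
  \<comment> \<open>Both factors have the same sign; \<open>l * (1 - l)\<close> times their product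
    is the convexity defect gained in passing from \<open>k\<close> to \<open>Suc k\<close>.\<close>
  have "0 \<le> (b - a) * (b ^ k - a ^ k)"
    using assms power_mono[of a b k] power_mono[of b a k] linear[of a b] by (auto simp: zero_le_mult_iff)
  then have "0 \<le> l * (1 - l) * ((b - a) * (b ^ k - a ^ k))"
    using assms by simp
  then have "((1 - l) * a + l * b) * ((1 - l) * a ^ k + l * b ^ k) \<le> (1 - l) * a ^ Suc k + l * b ^ Suc k"
    by (simp add: algebra_simps)
  moreover have "((1 - l) * a + l * b) ^ Suc k \<le> ((1 - l) * a + l * b) * ((1 - l) * a ^ k + l * b ^ k)"
    using Suc assms by (auto intro!: mult_left_mono)
  ultimately show ?case by linarith
qed auto

text \<open>The series of \<open>cosh\<close> has only even powers, with nonnegative coefficients,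
  so \<open>cosh\<close> is convex as a function of the square of its argument. The comparison is
  made term by term.\<close>

lemma cosh_convex_in_square:
  fixes r p q l :: real
  assumes "0 \<le> l" "l \<le> 1" "r\<^sup>2 = (1 - l) * p\<^sup>2 + l * q\<^sup>2"
  shows "cosh r \<le> (1 - l) * cosh p + l * cosh q"
proof (rule sums_le[OF _ cosh_converges sums_add[OF sums_mult[OF cosh_converges] sums_mult[OF cosh_converges]]])
  fix n :: nat
  show "(if even n then r ^ n /\<^sub>R fact n else 0)
      \<le> (1 - l) * (if even n then p ^ n /\<^sub>R fact n else 0) + l * (if even n then q ^ n /\<^sub>R fact n else 0)"
  proof (cases "even n")
    case True
    then obtain k where n: "n = 2 * k" by (elim evenE)
    have "r ^ n \<le> (1 - l) * p ^ n + l * q ^ n"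
      using power_convex_combination_le[OF assms(1,2), of "p\<^sup>2" "q\<^sup>2" k] assms(3)
      by (simp add: n power_mult)
    then have "inverse (fact n) * r ^ n \<le> inverse (fact n) * ((1 - l) * p ^ n + l * q ^ n)"
      by (intro mult_left_mono) auto
    then show ?thesis
      using True by (simp add: algebra_simps)
  qed auto
qed

lemma sinh_ge_self: "0 \<le> x \<Longrightarrow> x \<le> sinh x" for x :: real
  using real_le_x_sinh[of x] by (simp add: sinh_field_def exp_minus)

text \<open>As a function of the angle between \<open>x\<close> and \<open>w\<close>, \<open>cosh \<parallel>x + w\<parallel>\<close> lies below the chord
  between the two collinear cases.\<close>
lemma cosh_norm_add_le:
  fixes x w :: "'b::real_inner"
  shows "cosh (norm (x + w)) \<le> cosh (norm x) * (exp (norm w) - norm w) + sinh (norm x) / norm x * (x \<bullet> w)"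
proof -
  define r where "r = norm x"
  define d where "d = norm w"
  have rd: "0 \<le> r" "0 \<le> d" by (auto simp: r_def d_def)
  have exp_d: "exp d = cosh d + sinh d"
    by (simp add: cosh_plus_sinh)
  show ?thesis
  proof (cases "x = 0 \<or> w = 0")
    case True
    then show ?thesis
      using sinh_ge_self[OF rd(2)] exp_d by (auto simp: d_def)
  next
    case False
    then have pos: "0 < r" "0 < d" by (auto simp: r_def d_def)
    define c where "c = (x \<bullet> w) / (r * d)"
    have c: "-1 \<le> c" "c \<le> 1"
      using Cauchy_Schwarz_ineq2[of x w] pos by (auto simp: c_def r_def d_def field_simps abs_le_iff)
    have xw: "x \<bullet> w = r * d * c" using pos by (simp add: c_def)
    have "(norm (x + w))\<^sup>2 = r\<^sup>2 + d\<^sup>2 + 2 * (r * d * c)"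
      using xw by (simp add: power2_norm_eq_inner inner_add inner_commute[of w x] r_def d_def)
    also have "\<dots> = (1 - (1 + c) / 2) * (r - d)\<^sup>2 + (1 + c) / 2 * (r + d)\<^sup>2"
      by (simp add: power2_eq_square field_simps)
    finally have "cosh (norm (x + w)) \<le> (1 - (1 + c) / 2) * cosh (r - d) + (1 + c) / 2 * cosh (r + d)"
      using c by (intro cosh_convex_in_square) auto
    also have "\<dots> = cosh r * cosh d + c * (sinh r * sinh d)"
      by (simp add: cosh_add cosh_diff field_simps)
    \<comment> \<open>Only the excess \<open>sinh d - d\<close> is estimated; the part linear in
      \<open>w\<close> stays exact because it integrates to zero for centered
      \<open>w\<close>.\<close>
    also have "\<dots> = cosh r * cosh d + c * d * sinh r + c * (sinh r * (sinh d - d))"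
      by (simp add: algebra_simps)
    also have "c * (sinh r * (sinh d - d)) \<le> 1 * (cosh r * (sinh d - d))"
      using c rd sinh_ge_self[OF rd(2)] sinh_le_cosh_real[of r]
      by (intro mult_mono) auto
    also have "cosh r * cosh d + c * d * sinh r + 1 * (cosh r * (sinh d - d)) = cosh r * (exp d - d) + sinh r / r * (x \<bullet> w)"
      using pos by (simp add: exp_d xw field_simps)
    finally show ?thesis by (simp add: r_def d_def)
  qed
qed

lemma exp_minus_self_mono: "0 \<le> a \<Longrightarrow> a \<le> b \<Longrightarrow> exp a - a \<le> exp b - b" for a b :: real
proof -
  assume "0 \<le> a" "a \<le> b"
  then have "1 * (b - a) \<le> exp a * (b - a)"
    by (intro mult_right_mono) auto
  also have "\<dots> \<le> exp a * (exp (b - a) - 1)"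
    using exp_ge_add_one_self[of "b - a"] by (intro mult_left_mono) (linarith, simp)
  also have "\<dots> = exp b - exp a"
    by (simp add: algebra_simps flip: exp_add)
  finally show ?thesis by simp
qed

text \<open>The potential \<open>cosh (l * norm S)\<close> of the partial sum \<open>S\<close> grows
  in mean by at most \<open>\<rho>\<close> per sample: the linear term of
  \<open>cosh_norm_add_le\<close> vanishes by centering. The factor 2 comes from
  \<open>1 / cosh z \<le> 2 * exp (- z)\<close>.\<close>

lemma norm_sum_tail:
  fixes g :: "'a \<Rightarrow> 'b::euclidean_space" and n :: nat
  assumes M: "prob_space M" and [measurable]: "g \<in> borel_measurable M" and l: "0 < l"
    and int: "integrable M (\<lambda>y. exp (l * norm (g y)))"
    and centered: "\<And>x. (\<integral> y. x \<bullet> g y \<partial>M) = 0"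
    and \<rho>: "(\<integral> y. exp (l * norm (g y)) - l * norm (g y) \<partial>M) \<le> \<rho>"
  shows "1 - 2 * \<rho> ^ n * exp (- l * t)
           \<le> measure (PiM {..<n} (\<lambda>_. M)) {X \<in> space (PiM {..<n} (\<lambda>_. M)). norm (\<Sum>i<n. g (X i)) < t}"
proof (cases "0 < t")
  \<comment> \<open>Comparing with \<open>cosh (l * t)\<close> describes the event only for positive
    \<open>t\<close>. Here instead the left side is nonpositive, because \<open>\<rho>\<close> is at
    least 1.\<close>
  case False
  then have "0 \<le> l * (- t)"
    using l by (intro mult_nonneg_nonneg) auto
  moreover have "1 \<le> \<rho>"
  proof -
    interpret prob_space M by fact
    have "integrable M (\<lambda>y. norm (g y))"
      by (rule Bochner_Integration.integrable_bound[OF integrable_mult_right[OF int, of "1 / l"]])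
        (use l in \<open>auto intro!: AE_I2 simp: field_simps intro: order_trans[OF _ exp_ge_add_one_self]\<close>)
    then have "(\<integral> y. 1 \<partial>M) \<le> (\<integral> y. exp (l * norm (g y)) - l * norm (g y) \<partial>M)"
      using int exp_ge_add_one_self[of "l * norm (g _)"] by (intro integral_mono) (auto simp: algebra_simps)
    then show ?thesis using \<rho> by (simp add: prob_space)
  qed
  ultimately have "1 \<le> \<rho> ^ n * exp (- l * t)"
    by (intro mult_ge1_I) (auto simp: one_le_power)
  then have "1 - 2 * \<rho> ^ n * exp (- l * t) \<le> 0" by simp
  then show ?thesis by (rule order_trans) simp
next
  case t: True
  interpret prob_space M by fact
  interpret PP: prob_space "PiM {..<n} (\<lambda>_. M)"
    by (intro prob_space_PiM M)
  let ?F = "\<lambda>k X. ennreal (cosh (norm (l *\<^sub>R (\<Sum>i<k. g (X i)))))"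
  have int_g: "integrable M g"
    by (rule Bochner_Integration.integrable_bound[OF integrable_mult_right[OF int, of "1 / l"]])
      (use l in \<open>auto intro!: AE_I2 simp: field_simps intro: order_trans[OF _ exp_ge_add_one_self]\<close>)
  have \<rho>0: "0 \<le> \<rho>"
  proof -
    have "0 \<le> exp z - z" for z :: real
      using exp_ge_add_one_self[of z] by linarith
    then show ?thesis
      using order_trans[OF integral_nonneg_AE \<rho>] by auto
  qed
  have meas: "?F k \<in> borel_measurable (PiM {..<k} (\<lambda>_. M))" for k
    unfolding cosh_def by measurable
  have step: "(\<integral>\<^sup>+ y. ennreal (cosh (norm (x + l *\<^sub>R g y))) \<partial>M) \<le> ennreal \<rho> * ennreal (cosh (norm x))" for x
  proof -
    let ?h = "\<lambda>y. cosh (norm x) * (exp (norm (l *\<^sub>R g y)) - norm (l *\<^sub>R g y)) + sinh (norm x) / norm x * (x \<bullet> l *\<^sub>R g y)"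
    have int_h: "integrable M ?h"
      using int int_g l by (intro Bochner_Integration.integrable_add integrable_mult_right Bochner_Integration.integrable_diff) auto
    have "(\<integral>\<^sup>+ y. ennreal (cosh (norm (x + l *\<^sub>R g y))) \<partial>M) \<le> (\<integral>\<^sup>+ y. ennreal (?h y) \<partial>M)"
      by (intro nn_integral_mono ennreal_leI cosh_norm_add_le)
    also have "\<dots> = ennreal (\<integral> y. ?h y \<partial>M)"
      using order_trans[OF cosh_real_nonneg cosh_norm_add_le]
      by (intro nn_integral_eq_integral int_h AE_I2)
    also have "(\<integral> y. ?h y \<partial>M) = cosh (norm x) * (\<integral> y. exp (l * norm (g y)) - l * norm (g y) \<partial>M)"
      using int int_g l centered[of x] by simp
    also have "\<dots> \<le> cosh (norm x) * \<rho>"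
      by (intro mult_left_mono \<rho>) auto
    finally show ?thesis
      using \<rho>0 by (simp add: ennreal_leI ennreal_mult mult.commute)
  qed
  have "(\<integral>\<^sup>+ X. ?F n X \<partial>PiM {..<n} (\<lambda>_. M)) \<le> ennreal \<rho> ^ n * 1"
  proof (rule nn_integral_PiM_potential_le[OF M meas])
    fix k :: nat and X
    have "(\<Sum>i<k. g ((X(k := y)) i)) = (\<Sum>i<k. g (X i))" for y
      by (intro sum.cong) auto
    then show "(\<integral>\<^sup>+ y. ?F (Suc k) (X(k := y)) \<partial>M) \<le> ennreal \<rho> * ?F k X"
      using step[of "l *\<^sub>R (\<Sum>i<k. g (X i))"] by (simp only: sum.lessThan_Suc fun_upd_same scaleR_add_right)
  qed auto
  also have "\<dots> = ennreal (\<rho> ^ n)"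
    using \<rho>0 by (simp add: ennreal_power)
  finally have "1 - \<rho> ^ n / cosh (l * t) \<le> PP.prob {X \<in> space (PiM {..<n} (\<lambda>_. M)). ?F n X < ennreal (cosh (l * t))}"
    using \<rho>0 by (intro PP.prob_less_ge_Markov meas) auto
  moreover have "\<rho> ^ n / cosh (l * t) \<le> 2 * \<rho> ^ n * exp (- l * t)"
  proof -
    have "1 / cosh (l * t) \<le> 2 * exp (- l * t)"
      by (simp add: cosh_def exp_minus field_simps add_pos_pos)
    then show ?thesis
      using mult_left_mono[of "1 / cosh (l * t)" "2 * exp (- l * t)" "\<rho> ^ n"] \<rho>0 by (simp add: mult_ac)
  qed
  moreover have "?F n X < ennreal (cosh (l * t)) \<longleftrightarrow> norm (\<Sum>i<n. g (X i)) < t" for X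
    using l t by (simp add: ennreal_less_iff cosh_real_nonneg_less_iff)
  ultimately show ?thesis by simp
qed

section \<open>Least squares and whitening\<close>

text \<open>The first-order condition at a minimum. It yields the normal equations both for the
  sample and for the population.\<close>

lemma nonneg_quadratic_linear_coeff_eq_0:
  fixes R Z :: real
  assumes "\<And>t. 0 \<le> t\<^sup>2 * Z - 2 * t * R"
  shows "R = 0"
proof (rule ccontr)
  assume R: "R \<noteq> 0"
  \<comment> \<open>The added 1 keeps the denominator positive, also for \<open>Z = 0\<close>, and
    the quadratic term stays within half of the linear one.\<close>
  define t where "t = R / (\<bar>Z\<bar> + 1)"
  have t: "t * (\<bar>Z\<bar> + 1) = R" by (simp add: t_def)
  have "t\<^sup>2 * Z \<le> t\<^sup>2 * (\<bar>Z\<bar> + 1)"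
    by (intro mult_left_mono) auto
  also have "\<dots> = t * R"
    by (simp add: t[symmetric] power2_eq_square)
  finally have "t * R \<le> 0"
    using assms[of t] by linarith
  moreover have "t * R = R\<^sup>2 / (\<bar>Z\<bar> + 1)"
    by (simp add: t_def power2_eq_square)
  moreover have "0 < R\<^sup>2 / (\<bar>Z\<bar> + 1)"
    using R by (intro divide_pos_pos) auto
  ultimately show False by linarith
qed

text \<open>With \<open>m\<close>, \<open>s\<close>, \<open>w\<close> the means of
  \<open>u i\<close>, \<open>e i\<close>, \<open>e i *\<^sub>R u i\<close>, the normal equations
  give \<open>a = s - c \<bullet> m\<close> and express the centered second moment of
  \<open>c \<bullet> u i\<close> as \<open>c \<bullet> w - s * (c \<bullet> m)\<close>. The former
  is at least \<open>(\<kappa> - U\<^sup>2) * (norm c)\<^sup>2\<close>, the latter at most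
  \<open>norm c * (W + U * V)\<close>, which bounds \<open>norm c\<close>.\<close>

lemma least_squares_intercept_bound:
  fixes u :: "nat \<Rightarrow> 'b::real_inner" and e :: "nat \<Rightarrow> real" and n :: nat and a \<kappa> U V W :: real
  assumes n: "0 < n"
    and min: "\<And>a' c'. (\<Sum>i<n. (e i - a - c \<bullet> u i)\<^sup>2) \<le> (\<Sum>i<n. (e i - a' - c' \<bullet> u i)\<^sup>2)"
    and \<kappa>: "\<And>x. \<kappa> * n * (norm x)\<^sup>2 \<le> (\<Sum>i<n. (u i \<bullet> x)\<^sup>2)"
    and U: "norm (\<Sum>i<n. u i) \<le> U * n"
    and V: "\<bar>\<Sum>i<n. e i\<bar> \<le> V * n"
    and W: "norm (\<Sum>i<n. e i *\<^sub>R u i) \<le> W * n"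
    and U\<kappa>: "U\<^sup>2 < \<kappa>"
  shows "\<bar>a\<bar> \<le> V + (W + U * V) / (\<kappa> - U\<^sup>2) * U"
proof -
  define r where "r i = e i - a - c \<bullet> u i" for i
  have normal: "(\<Sum>i<n. r i * (\<alpha> + \<gamma> \<bullet> u i)) = 0" for \<alpha> \<gamma>
  proof (rule nonneg_quadratic_linear_coeff_eq_0)
    fix t :: real
    have "(\<Sum>i<n. (r i)\<^sup>2) \<le> (\<Sum>i<n. (r i - t * (\<alpha> + \<gamma> \<bullet> u i))\<^sup>2)"
      using min[of "a + t * \<alpha>" "c + t *\<^sub>R \<gamma>"] by (simp add: r_def inner_add_left algebra_simps)
    also have "\<dots> = (\<Sum>i<n. (r i)\<^sup>2) + (t\<^sup>2 * (\<Sum>i<n. (\<alpha> + \<gamma> \<bullet> u i)\<^sup>2) - 2 * t * (\<Sum>i<n. r i * (\<alpha> + \<gamma> \<bullet> u i)))"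
      by (simp add: power2_diff power_mult_distrib sum.distrib sum_subtractf sum_distrib_left mult_ac)
    finally show "0 \<le> t\<^sup>2 * (\<Sum>i<n. (\<alpha> + \<gamma> \<bullet> u i)\<^sup>2) - 2 * t * (\<Sum>i<n. r i * (\<alpha> + \<gamma> \<bullet> u i))"
      by simp
  qed
  define m where "m = (1 / n) *\<^sub>R (\<Sum>i<n. u i)"
  define s where "s = (\<Sum>i<n. e i) / n"
  define w where "w = (1 / n) *\<^sub>R (\<Sum>i<n. e i *\<^sub>R u i)"
  define q where "q = (\<Sum>i<n. (c \<bullet> u i)\<^sup>2) / n"
  have m: "norm m \<le> U" and s: "\<bar>s\<bar> \<le> V" and w: "norm w \<le> W"
    using U V W n by (simp_all add: m_def s_def w_def field_simps)
  have U0: "0 \<le> U" and V0: "0 \<le> V"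
    using m s norm_ge_zero[of m] by linarith+
  have cm: "(\<Sum>i<n. c \<bullet> u i) = n * (c \<bullet> m)"
    using n by (simp add: m_def inner_sum_right)
  \<comment> \<open>Two test functions are used: residuals are orthogonal to constants here, and to
    the fitted linear part below.\<close>
  have "(\<Sum>i<n. e i) = a * n + (\<Sum>i<n. c \<bullet> u i)"
    using normal[of 1 0] by (simp add: r_def sum_subtractf) (simp add: diff_eq_eq add.commute mult.commute)
  then have a: "a = s - c \<bullet> m"
    using n by (simp add: s_def cm field_simps)
  have "(\<Sum>i<n. e i * (c \<bullet> u i)) = a * (\<Sum>i<n. c \<bullet> u i) + (\<Sum>i<n. (c \<bullet> u i)\<^sup>2)"
    using normal[of 0 c] by (simp add: r_def left_diff_distrib sum_subtractf sum_distrib_left power2_eq_square)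
  then have "c \<bullet> w = a * (c \<bullet> m) + q"
    using n by (simp add: w_def q_def cm inner_sum_right field_simps)
  then have q: "q - (c \<bullet> m)\<^sup>2 = c \<bullet> w - s * (c \<bullet> m)"
    by (simp add: a power2_eq_square algebra_simps)
  have c_m: "\<bar>c \<bullet> m\<bar> \<le> norm c * U"
    using Cauchy_Schwarz_ineq2[of c m] mult_left_mono[OF m, of "norm c"] by simp
  have "(\<kappa> - U\<^sup>2) * (norm c)\<^sup>2 \<le> q - (c \<bullet> m)\<^sup>2"
  proof -
    have "\<kappa> * (norm c)\<^sup>2 \<le> q"
      using \<kappa>[of c] n by (simp add: q_def inner_commute field_simps)
    moreover have "(c \<bullet> m)\<^sup>2 \<le> (norm c * U)\<^sup>2"
      using c_m by (simp add: abs_le_square_iff[symmetric] U0 abs_mult)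
    ultimately show ?thesis
      by (simp add: algebra_simps power_mult_distrib)
  qed
  also have "q - (c \<bullet> m)\<^sup>2 \<le> norm c * W + V * (norm c * U)"
  proof -
    have "c \<bullet> w \<le> norm c * W"
      using norm_cauchy_schwarz[of c w] mult_left_mono[OF w, of "norm c"] by simp
    moreover have "\<bar>s * (c \<bullet> m)\<bar> \<le> V * (norm c * U)"
      unfolding abs_mult using s c_m V0 by (intro mult_mono) auto
    ultimately show ?thesis
      unfolding q by linarith
  qed
  finally have "norm c * ((\<kappa> - U\<^sup>2) * norm c) \<le> norm c * (W + U * V)"
    by (simp add: power2_eq_square algebra_simps)
  moreover have WUV: "0 \<le> W + U * V"
    using w norm_ge_zero[of w] U0 V0 by (simp add: order_trans[OF norm_ge_zero w])
  ultimately have "(\<kappa> - U\<^sup>2) * norm c \<le> W + U * V"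
    by (cases "c = 0") auto
  then have "norm c \<le> (W + U * V) / (\<kappa> - U\<^sup>2)"
    using U\<kappa> by (simp add: field_simps)
  from mult_right_mono[OF this U0] show ?thesis
    using a c_m s by linarith
qed

text \<open>Gram-Schmidt for the inner product \<open>x \<bullet> G y\<close>; indexing by basis
  vectors matches the family with an orthonormal basis.\<close>

lemma pd_op_orthonormal_family:
  fixes G :: "'b::euclidean_space \<Rightarrow> 'b"
  assumes G: "pd_op G" and C: "C \<subseteq> Basis"
  shows "\<exists>e :: 'b \<Rightarrow> 'b. \<forall>b\<in>C. \<forall>c\<in>C. e b \<bullet> G (e c) = (if b = c then 1 else 0)"
proof -
  have "finite C" using C finite_Basis by (rule finite_subset)
  then show ?thesis using C
  proof (induction C rule: finite_induct)
    case (insert b C)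
    then obtain e :: "'b \<Rightarrow> 'b" where e: "\<And>c d. c \<in> C \<Longrightarrow> d \<in> C \<Longrightarrow> e c \<bullet> G (e d) = (if c = d then 1 else 0)"
      by auto
    \<comment> \<open>Fewer than \<open>DIM('b)\<close> vectors cannot span the space, so there is a
      new direction to orthogonalize.\<close>
    have "dim (span (e ` C)) \<le> card (e ` C)"
      using insert.hyps by (simp add: dim_le_card')
    also have "\<dots> \<le> card C" using insert.hyps by (intro card_image_le)
    also have "\<dots> < card (insert b C)" using insert.hyps by simp
    also have "\<dots> \<le> DIM('b)" using insert.prems by (intro card_mono) auto
    finally have "span (e ` C) \<noteq> UNIV" by (metis dim_UNIV less_irrefl)
    then obtain x where x: "x \<notin> span (e ` C)" by auto
    define z where "z = x - (\<Sum>c\<in>C. (x \<bullet> G (e c)) *\<^sub>R e c)"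
    have "z \<noteq> 0"
    proof
      assume "z = 0"
      then have "x = (\<Sum>c\<in>C. (x \<bullet> G (e c)) *\<^sub>R e c)" by (simp add: z_def)
      also have "\<dots> \<in> span (e ` C)"
        by (intro span_sum span_scale span_base) auto
      finally show False using x by simp
    qed
    then have zz: "0 < z \<bullet> G z" by (rule pd_opD(3)[OF G])
    have ze: "z \<bullet> G (e c) = 0" if "c \<in> C" for c
    proof -
      have "(\<Sum>d\<in>C. (x \<bullet> G (e d)) * (e d \<bullet> G (e c))) = (\<Sum>d\<in>C. if d = c then x \<bullet> G (e c) else 0)"
        using e that by (intro sum.cong) auto
      then show ?thesis
        using that insert.hyps by (simp add: z_def inner_diff_left inner_sum_left)
    qed
    then have ez: "e c \<bullet> G z = 0" if "c \<in> C" for c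
      using that by (metis pd_opD(2)[OF G] inner_commute)
    let ?e = "e(b := (1 / sqrt (z \<bullet> G z)) *\<^sub>R z)"
    have "?e c \<bullet> G (?e d) = (if c = d then 1 else 0)" if "c \<in> insert b C" "d \<in> insert b C" for c d
      using that e ze ez zz insert.hyps
      by (auto simp: linear_scale[OF pd_opD(1)[OF G]] simp flip: power2_eq_square)
    then show ?case by blast
  qed auto
qed

text \<open>\<open>S\<close> plays the role of \<open>G\<^sup>-\<^sup>1\<^sup>/\<^sup>2\<close>: it maps an orthonormal basis to one that is orthonormal
  for the inner product defined by \<open>G\<close>.\<close>
lemma pd_op_whitening:
  fixes G :: "'b::euclidean_space \<Rightarrow> 'b"
  assumes G: "pd_op G"
  obtains S :: "'b \<Rightarrow> 'b" where "linear S" "surj S" "\<And>x y. S x \<bullet> G (S y) = x \<bullet> y"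
proof -
  obtain e :: "'b \<Rightarrow> 'b" where e: "\<And>b c. b \<in> Basis \<Longrightarrow> c \<in> Basis \<Longrightarrow> e b \<bullet> G (e c) = (if b = c then 1 else 0)"
    using pd_op_orthonormal_family[OF G order_refl] by blast
  define S where "S x = (\<Sum>b\<in>Basis. (x \<bullet> b) *\<^sub>R e b)" for x
  have lin: "linear S"
    by (rule linearI) (simp_all add: S_def inner_add_left scaleR_add_left sum.distrib scaleR_sum_right)
  note linG = pd_opD(1)[OF G]
  have iso: "S x \<bullet> G (S y) = x \<bullet> y" for x y
  proof -
    have "S x \<bullet> G (S y) = (\<Sum>b\<in>Basis. \<Sum>c\<in>Basis. (x \<bullet> b) * (y \<bullet> c) * (e b \<bullet> G (e c)))"
      by (simp add: S_def linear_sum[OF linG] linear_scale[OF linG] inner_sum_left inner_sum_right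
          sum_distrib_left mult_ac)
        (rule sum.swap)
    also have "\<dots> = (\<Sum>b\<in>Basis. \<Sum>c\<in>Basis. if b = c then (x \<bullet> b) * (y \<bullet> c) else 0)"
      by (intro sum.cong) (auto simp: e)
    also have "\<dots> = x \<bullet> y"
      by (simp add: euclidean_inner[of x y])
    finally show ?thesis .
  qed
  \<comment> \<open>Injectivity follows from the isometry identity; finite dimension turns it into
    surjectivity.\<close>
  have "inj S"
  proof (rule injI)
    fix x y assume "S x = S y"
    then have "(x - y) \<bullet> (x - y) = 0"
      using iso[of "x - y" "x - y"] by (simp add: linear_diff[OF lin])
    then show "x = y" by simp
  qed
  then show ?thesis
    using lin iso linear_injective_imp_surjective that by blast
qed

section \<open>Tail bounds under sub-Gaussian errors\<close>

lemma subgaussian_fun_nn_integral_exp: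
  assumes "subgaussian_fun M eps v"
  shows "eps \<in> borel_measurable M" "(\<integral>\<^sup>+ x. ennreal (exp (l * eps x)) \<partial>M) \<le> ennreal (exp (l\<^sup>2 * v / 2))"
  using assms by (auto simp: subgaussian_fun_def)

lemma subgaussian_fun_integral_exp:
  assumes "subgaussian_fun M eps v"
  shows "integrable M (\<lambda>x. exp (l * eps x))" "(\<integral> x. exp (l * eps x) \<partial>M) \<le> exp (l\<^sup>2 * v / 2)"
proof -
  note [measurable] = subgaussian_fun_nn_integral_exp(1)[OF assms]
  have lt: "(\<integral>\<^sup>+ x. ennreal (exp (l * eps x)) \<partial>M) < \<infinity>"
    using subgaussian_fun_nn_integral_exp(2)[OF assms, of l] by (simp add: le_less_trans)
  then show int: "integrable M (\<lambda>x. exp (l * eps x))"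
    by (intro integrableI_nonneg) auto
  have "ennreal (\<integral> x. exp (l * eps x) \<partial>M) \<le> ennreal (exp (l\<^sup>2 * v / 2))"
    using subgaussian_fun_nn_integral_exp(2)[OF assms, of l] nn_integral_eq_integral[OF int] by simp
  then show "(\<integral> x. exp (l * eps x) \<partial>M) \<le> exp (l\<^sup>2 * v / 2)"
    by simp
qed

lemma subgaussian_fun_integral_cosh:
  assumes "subgaussian_fun M eps v"
  shows "integrable M (\<lambda>x. cosh (l * eps x))" "(\<integral> x. cosh (l * eps x) \<partial>M) \<le> exp (l\<^sup>2 * v / 2)"
  using subgaussian_fun_integral_exp[OF assms, of l] subgaussian_fun_integral_exp[OF assms, of "- l"]
  by (auto simp: cosh_field_def)

text \<open>Chernoff's bound for both tails at once: the potential is the sum of the two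
  exponentials, and its initial value is the factor 2.\<close>

lemma subgaussian_sum_tail:
  fixes eps :: "'a \<Rightarrow> real" and n :: nat and \<tau> t :: real
  assumes M: "prob_space M" and sg: "subgaussian_fun M eps (\<tau>\<^sup>2)"
    and pos: "0 < \<tau>" "0 < n" "0 < t"
  shows "1 - 2 * exp (- t\<^sup>2 / (2 * n * \<tau>\<^sup>2))
           \<le> measure (PiM {..<n} (\<lambda>_. M)) {X \<in> space (PiM {..<n} (\<lambda>_. M)). \<bar>\<Sum>i<n. eps (X i)\<bar> < t}"
proof -
  interpret prob_space M by fact
  interpret PP: prob_space "PiM {..<n} (\<lambda>_. M)"
    by (intro prob_space_PiM M)
  note [measurable] = subgaussian_fun_nn_integral_exp(1)[OF sg]
  \<comment> \<open>The minimizer of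
    \<open>n * l\<^sup>2 * \<tau>\<^sup>2 / 2 - l * t\<close>.\<close>
  define l where "l = t / (n * \<tau>\<^sup>2)"
  have l: "0 < l" using pos by (simp add: l_def)
  let ?\<rho> = "exp (l\<^sup>2 * \<tau>\<^sup>2 / 2)"
  let ?F = "\<lambda>k X. ennreal (exp (l * (\<Sum>i<k. eps (X i)))) + ennreal (exp (- l * (\<Sum>i<k. eps (X i))))"
  have meas: "?F k \<in> borel_measurable (PiM {..<k} (\<lambda>_. M))" for k
    by measurable
  have step: "(\<integral>\<^sup>+ y. ennreal (exp (a * (s + eps y))) \<partial>M) \<le> ennreal (exp (a\<^sup>2 * \<tau>\<^sup>2 / 2)) * ennreal (exp (a * s))" for a s
  proof -
    have "(\<integral>\<^sup>+ y. ennreal (exp (a * (s + eps y))) \<partial>M) = (\<integral>\<^sup>+ y. ennreal (exp (a * s)) * ennreal (exp (a * eps y)) \<partial>M)"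
      by (simp add: distrib_left exp_add ennreal_mult)
    also have "\<dots> = ennreal (exp (a * s)) * (\<integral>\<^sup>+ y. ennreal (exp (a * eps y)) \<partial>M)"
      by (rule nn_integral_cmult) measurable
    also have "\<dots> \<le> ennreal (exp (a * s)) * ennreal (exp (a\<^sup>2 * \<tau>\<^sup>2 / 2))"
      by (intro mult_left_mono subgaussian_fun_nn_integral_exp(2)[OF sg]) auto
    finally show ?thesis by (simp add: mult.commute)
  qed
  have "(\<integral>\<^sup>+ X. ?F n X \<partial>PiM {..<n} (\<lambda>_. M)) \<le> ennreal ?\<rho> ^ n * 2"
  proof (rule nn_integral_PiM_potential_le[OF M meas])
    fix k :: nat and X
    let ?s = "\<Sum>i<k. eps (X i)"
    have "(\<Sum>i<k. eps ((X(k := y)) i)) = ?s" for y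
      by (intro sum.cong) auto
    then have "(\<integral>\<^sup>+ y. ?F (Suc k) (X(k := y)) \<partial>M)
        = (\<integral>\<^sup>+ y. ennreal (exp (l * (?s + eps y))) + ennreal (exp (- l * (?s + eps y))) \<partial>M)"
      by (simp only: sum.lessThan_Suc fun_upd_same)
    also have "\<dots> = (\<integral>\<^sup>+ y. ennreal (exp (l * (?s + eps y))) \<partial>M) + (\<integral>\<^sup>+ y. ennreal (exp (- l * (?s + eps y))) \<partial>M)"
      by (rule nn_integral_add) measurable
    also have "\<dots> \<le> ennreal ?\<rho> * ?F k X"
      using add_mono[OF step[of l ?s] step[of "- l" ?s]] by (simp add: distrib_left)
    finally show "(\<integral>\<^sup>+ y. ?F (Suc k) (X(k := y)) \<partial>M) \<le> ennreal ?\<rho> * ?F k X" .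
  qed auto
  also have "\<dots> = ennreal (2 * ?\<rho> ^ n)"
    by (simp add: ennreal_power ennreal_mult mult.commute)
  finally have "1 - 2 * ?\<rho> ^ n / exp (l * t) \<le> PP.prob {X \<in> space (PiM {..<n} (\<lambda>_. M)). ?F n X < ennreal (exp (l * t))}"
    by (intro PP.prob_less_ge_Markov meas) auto
  also have "\<dots> \<le> PP.prob {X \<in> space (PiM {..<n} (\<lambda>_. M)). \<bar>\<Sum>i<n. eps (X i)\<bar> < t}"
  proof (intro PP.finite_measure_mono subsetI CollectI conjI)
    fix X assume X: "X \<in> {X \<in> space (PiM {..<n} (\<lambda>_. M)). ?F n X < ennreal (exp (l * t))}"
    let ?s = "\<Sum>i<n. eps (X i)"
    have "exp (l * ?s) + exp (- l * ?s) < exp (l * t)"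
      using X by (simp add: ennreal_less_iff flip: ennreal_plus)
    then have "exp (l * ?s) < exp (l * t)" "exp (- l * ?s) < exp (l * t)"
      using exp_gt_zero[of "l * ?s"] exp_gt_zero[of "- l * ?s"] by linarith+
    then have "l * ?s < l * t" "l * (- ?s) < l * t"
      by simp_all
    then show "\<bar>?s\<bar> < t"
      unfolding mult_less_cancel_left_pos[OF l] by (simp add: abs_less_iff)
  qed auto
  finally have "1 - 2 * ?\<rho> ^ n / exp (l * t) \<le> PP.prob {X \<in> space (PiM {..<n} (\<lambda>_. M)). \<bar>\<Sum>i<n. eps (X i)\<bar> < t}" .
  moreover have "?\<rho> ^ n / exp (l * t) = exp (- t\<^sup>2 / (2 * n * \<tau>\<^sup>2))"
  proof -
    have "?\<rho> ^ n / exp (l * t) = exp (n * (l\<^sup>2 * \<tau>\<^sup>2 / 2) - l * t)"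
      by (simp only: exp_diff exp_of_nat_mult)
    also have "n * (l\<^sup>2 * \<tau>\<^sup>2 / 2) - l * t = - t\<^sup>2 / (2 * n * \<tau>\<^sup>2)"
      using pos by (simp add: l_def field_simps power2_eq_square)
    finally show ?thesis .
  qed
  ultimately show ?thesis by simp
qed

text \<open>The trace of the covariance identity. Its consequence \<open>DIM('b) \<le> B\<close>
  later makes \<open>B\<close> at least 1.\<close>

lemma isotropic_integral_norm_square:
  fixes u :: "'a \<Rightarrow> 'b::euclidean_space" and B :: real
  assumes M: "prob_space M" and u: "u \<in> borel_measurable M" "\<And>y. y \<in> space M \<Longrightarrow> (norm (u y))\<^sup>2 \<le> B"
    and cov: "\<And>x y. (\<integral> z. (u z \<bullet> x) * (u z \<bullet> y) \<partial>M) = x \<bullet> y"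
  shows "integrable M (\<lambda>y. (norm (u y))\<^sup>2)" "(\<integral> y. (norm (u y))\<^sup>2 \<partial>M) = DIM('b)" "DIM('b) \<le> B"
proof -
  interpret prob_space M by fact
  note int = integrable_inner_product_bounded[OF M u]
  have norm_eq: "(norm (u y))\<^sup>2 = (\<Sum>b\<in>Basis. (u y \<bullet> b) * (u y \<bullet> b))" for y
    by (simp add: power2_norm_eq_inner euclidean_inner[of "u y" "u y"])
  show i: "integrable M (\<lambda>y. (norm (u y))\<^sup>2)"
    unfolding norm_eq by (intro Bochner_Integration.integrable_sum int)
  show eq: "(\<integral> y. (norm (u y))\<^sup>2 \<partial>M) = DIM('b)"
    unfolding norm_eq by (subst Bochner_Integration.integral_sum) (auto simp: int cov)
  have "(\<integral> y. (norm (u y))\<^sup>2 \<partial>M) \<le> (\<integral> y. B \<partial>M)"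
    by (intro integral_mono_AE i AE_I2 u) auto
  then show "DIM('b) \<le> B"
    using eq by (simp add: prob_space)
qed

text \<open>For \<open>l * norm (u y) \<le> 1\<close> the bound
  \<open>exp z \<le> 1 + z + z\<^sup>2\<close> applies, so the growth rate involves the mean square
  \<open>DIM('b)\<close> instead of the uniform bound \<open>B\<close>.\<close>

lemma isotropic_sum_tail:
  fixes u :: "'a \<Rightarrow> 'b::euclidean_space" and n :: nat and B l t :: real
  assumes M: "prob_space M" and u: "u \<in> borel_measurable M" "\<And>y. y \<in> space M \<Longrightarrow> (norm (u y))\<^sup>2 \<le> B"
    and cov: "\<And>x y. (\<integral> z. (u z \<bullet> x) * (u z \<bullet> y) \<partial>M) = x \<bullet> y"
    and centered: "\<And>x. (\<integral> y. x \<bullet> u y \<partial>M) = 0"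
    and l: "0 < l" "l\<^sup>2 * B \<le> 1"
  shows "1 - 2 * exp (n * (l\<^sup>2 * DIM('b)) - l * t)
           \<le> measure (PiM {..<n} (\<lambda>_. M)) {X \<in> space (PiM {..<n} (\<lambda>_. M)). norm (\<Sum>i<n. u (X i)) < t}"
proof -
  interpret prob_space M by fact
  note [measurable] = u(1)
  note sq = isotropic_integral_norm_square[OF M u cov]
  have small: "l * norm (u y) \<le> 1" if "y \<in> space M" for y
  proof -
    have "(l * norm (u y))\<^sup>2 \<le> l\<^sup>2 * B"
      using u(2)[OF that] by (simp add: power_mult_distrib mult_left_mono)
    then have "(l * norm (u y))\<^sup>2 \<le> 1\<^sup>2" using l by simp
    then show ?thesis by (rule power2_le_imp_le) simp
  qed
  have int: "integrable M (\<lambda>y. exp (l * norm (u y)))"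
    by (rule integrable_const_bound[where B = "exp 1"]) (use small in \<open>auto intro!: AE_I2\<close>)
  have int_norm: "integrable M (\<lambda>y. norm (u y))"
    by (rule integrable_const_bound[where B = "1 / l"]) (use small l in \<open>auto intro!: AE_I2 simp: field_simps\<close>)
  have "(\<integral> y. exp (l * norm (u y)) - l * norm (u y) \<partial>M) \<le> (\<integral> y. 1 + l\<^sup>2 * (norm (u y))\<^sup>2 \<partial>M)"
  proof (intro integral_mono_AE AE_I2)
    fix y assume "y \<in> space M"
    then show "exp (l * norm (u y)) - l * norm (u y) \<le> 1 + l\<^sup>2 * (norm (u y))\<^sup>2"
      using exp_bound[OF _ small, of y] l by (simp add: power_mult_distrib)
  qed (use int int_norm sq(1) in auto)
  also have "\<dots> = 1 + l\<^sup>2 * DIM('b)"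
    using sq by (simp add: prob_space)
  also have "\<dots> \<le> exp (l\<^sup>2 * DIM('b))"
    by (rule exp_ge_add_one_self)
  finally have "1 - 2 * exp (l\<^sup>2 * DIM('b)) ^ n * exp (- l * t)
           \<le> measure (PiM {..<n} (\<lambda>_. M)) {X \<in> space (PiM {..<n} (\<lambda>_. M)). norm (\<Sum>i<n. u (X i)) < t}"
    by (intro norm_sum_tail[OF M u(1) l(1) int centered])
  moreover have "exp (l\<^sup>2 * DIM('b)) ^ n * exp (- l * t) = exp (n * (l\<^sup>2 * DIM('b)) - l * t)"
    by (simp only: exp_of_nat_mult[symmetric] exp_add[symmetric]) simp
  ultimately show ?thesis by (simp only: mult.assoc)
qed

lemma exp_minus_self_le_cosh: "0 \<le> y \<Longrightarrow> exp y - y \<le> 2 * cosh y - 1" for y :: real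
  using exp_ge_add_one_self[of "- y"] by (simp add: cosh_field_def field_simps)

text \<open>The norm of the summand is at most \<open>sqrt B * \<bar>eps y\<bar>\<close>, and
  \<open>exp z - z \<le> 2 * cosh z - 1\<close> reduces the growth rate to the exponential moments
  of \<open>eps\<close>.\<close>

lemma subgaussian_product_sum_tail:
  fixes u :: "'a \<Rightarrow> 'b::euclidean_space" and eps :: "'a \<Rightarrow> real" and n :: nat and \<tau> l t :: real
  assumes M: "prob_space M" and u: "u \<in> borel_measurable M" "\<And>y. y \<in> space M \<Longrightarrow> (norm (u y))\<^sup>2 \<le> B"
    and B: "0 < B" and sg: "subgaussian_fun M eps (\<tau>\<^sup>2)"
    and centered: "\<And>x. (\<integral> y. eps y * (x \<bullet> u y) \<partial>M) = 0"
    and l: "0 < l"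
  shows "1 - 2 * exp (n * (l\<^sup>2 * B * \<tau>\<^sup>2) - l * t)
           \<le> measure (PiM {..<n} (\<lambda>_. M)) {X \<in> space (PiM {..<n} (\<lambda>_. M)). norm (\<Sum>i<n. eps (X i) *\<^sub>R u (X i)) < t}"
proof -
  interpret prob_space M by fact
  note [measurable] = u(1) subgaussian_fun_nn_integral_exp(1)[OF sg]
  let ?g = "\<lambda>y. eps y *\<^sub>R u y"
  define k where "k = l * sqrt B"
  have k: "0 < k" "k\<^sup>2 = l\<^sup>2 * B"
    using l B by (auto simp: k_def power_mult_distrib)
  note cosh = subgaussian_fun_integral_cosh[OF sg, of k]
  have le: "l * norm (?g y) \<le> \<bar>k * eps y\<bar>" if "y \<in> space M" for y
  proof -
    have "norm (u y) \<le> sqrt B"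
      using u(2)[OF that] by (simp add: real_le_rsqrt)
    then have "l * (\<bar>eps y\<bar> * norm (u y)) \<le> l * (\<bar>eps y\<bar> * sqrt B)"
      using l by (intro mult_left_mono) auto
    then show ?thesis
      using l B by (simp add: k_def abs_mult mult_ac)
  qed
  have pt: "exp (l * norm (?g y)) - l * norm (?g y) \<le> 2 * cosh (k * eps y) - 1" if "y \<in> space M" for y
    using exp_minus_self_mono[OF _ le[OF that]] exp_minus_self_le_cosh[of "\<bar>k * eps y\<bar>"] l by simp
  have expc: "exp \<bar>z\<bar> \<le> 2 * cosh z" for z :: real
    by (cases "0 \<le> z") (auto simp: cosh_field_def)
  have int: "integrable M (\<lambda>y. exp (l * norm (?g y)))"
  proof (rule Bochner_Integration.integrable_bound[OF integrable_mult_right[OF cosh(1), of 2]])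
    show "AE y in M. norm (exp (l * norm (?g y))) \<le> norm (2 * cosh (k * eps y))"
    proof (rule AE_I2)
      fix y assume "y \<in> space M"
      then have "exp (l * norm (?g y)) \<le> exp \<bar>k * eps y\<bar>"
        using le by (simp only: exp_le_cancel_iff)
      also note expc
      finally show "norm (exp (l * norm (?g y))) \<le> norm (2 * cosh (k * eps y))"
        by simp
    qed
  qed measurable
  have int_norm: "integrable M (\<lambda>y. l * norm (?g y))"
    by (rule Bochner_Integration.integrable_bound[OF int])
      (use l in \<open>auto intro!: AE_I2 intro: order_trans[OF _ exp_ge_add_one_self]\<close>)
  have "(\<integral> y. exp (l * norm (?g y)) - l * norm (?g y) \<partial>M) \<le> (\<integral> y. 2 * cosh (k * eps y) - 1 \<partial>M)"
    by (intro integral_mono_AE AE_I2 pt Bochner_Integration.integrable_diff int int_norm) (use cosh(1) in auto)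
  also have "\<dots> = 2 * (\<integral> y. cosh (k * eps y) \<partial>M) - 1"
    using cosh(1) by (simp add: prob_space)
  also have "\<dots> \<le> 2 * exp (k\<^sup>2 * \<tau>\<^sup>2 / 2) - 1"
    using cosh(2) by simp
  \<comment> \<open>\<open>2 * z - 1 \<le> z\<^sup>2\<close> absorbs the factor 2, which would
    otherwise be raised to the power \<open>n\<close>.\<close>
  also have "\<dots> \<le> (exp (k\<^sup>2 * \<tau>\<^sup>2 / 2))\<^sup>2"
    using zero_le_power2[of "exp (k\<^sup>2 * \<tau>\<^sup>2 / 2) - 1"] by (simp add: power2_diff)
  also have "\<dots> = exp (l\<^sup>2 * B * \<tau>\<^sup>2)"
    by (simp add: k(2) flip: exp_double)
  finally have "1 - 2 * exp (l\<^sup>2 * B * \<tau>\<^sup>2) ^ n * exp (- l * t)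
           \<le> measure (PiM {..<n} (\<lambda>_. M)) {X \<in> space (PiM {..<n} (\<lambda>_. M)). norm (\<Sum>i<n. ?g (X i)) < t}"
    by (intro norm_sum_tail[OF M _ l int]) (auto simp: centered)
  moreover have "exp (l\<^sup>2 * B * \<tau>\<^sup>2) ^ n * exp (- l * t) = exp (n * (l\<^sup>2 * B * \<tau>\<^sup>2) - l * t)"
    by (simp only: exp_of_nat_mult[symmetric] exp_add[symmetric]) simp
  ultimately show ?thesis by (simp only: mult.assoc)
qed

section \<open>Intersection of the events and numerical constants\<close>

lemma (in prob_space) prob_Int_ge:
  assumes "A \<in> events" "C \<in> events" "1 - a \<le> prob A" "1 - c \<le> prob C"
  shows "1 - (a + c) \<le> prob (A \<inter> C)"
proof -
  have "prob (A \<union> C) = prob A + prob C - prob (A \<inter> C)"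
    using assms by (simp add: finite_measure_Union' Diff_Int_distrib2 finite_measure_Diff' Int_commute)
  then show ?thesis
    using assms prob_le_1[of "A \<union> C"] by linarith
qed

text \<open>The size of \<open>n\<close> gives \<open>U\<^sup>2 \<le> 2 / 25\<close>, so the
  denominator is at least \<open>4 / 25\<close>. In units of
  \<open>R = \<tau> * sqrt (B * L8 / n)\<close>, \<open>W\<close> is 2 and \<open>U * V\<close> at
  most \<open>2 / 5\<close>, so the quotient is at most 15. Finally
  \<open>15\<^sup>2 * 6 = 1350 \<le> 58\<^sup>2\<close>.\<close>

lemma intercept_bound_arithmetic:
  fixes m B L L8 Lm n \<tau> :: real
  assumes m: "1 \<le> m" "m \<le> B" and L: "0 < L" "0 < L8" "L8 \<le> Lm" and \<tau>: "0 < \<tau>" and n: "75 * m * L \<le> n"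
  defines "U \<equiv> sqrt (6 * m * L / n)" and "V \<equiv> \<tau> * sqrt (2 * L8 / n)" and "W \<equiv> 2 * \<tau> * sqrt (B * L8 / n)"
  shows "U\<^sup>2 < 6 / 25"
    and "V + (W + U * V) / (6 / 25 - U\<^sup>2) * U \<le> sqrt (2 * L8) * \<tau> / sqrt n + 58 * sqrt (B * m * Lm * L) * \<tau> / n"
proof -
  have n0: "0 < n"
    using n m L mult_pos_pos[of m L] by linarith
  have U2: "U\<^sup>2 = 6 * m * L / n"
    using m L n0 by (simp add: U_def)
  also have U2_le: "6 * m * L / n \<le> 2 / 25"
    using n n0 by (simp add: field_simps)
  finally have U2': "U\<^sup>2 \<le> 2 / 25" .
  then show "U\<^sup>2 < 6 / 25" by linarith
  have B: "0 < B" using m by linarith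
  have nonneg: "0 \<le> U" "0 \<le> V" "0 \<le> W"
    using m L \<tau> n0 B by (auto simp: U_def V_def W_def)
  define R where "R = \<tau> * sqrt (B * L8 / n)"
  have R: "0 \<le> R" using \<tau> B L n0 by (simp add: R_def)
  \<comment> \<open>Since \<open>B\<close> is at least 1, \<open>V\<close> can be compared with
    \<open>R\<close>.\<close>
  have "L8 \<le> B * L8" using m L by simp
  then have "\<tau>\<^sup>2 * (2 * L8 / n) \<le> \<tau>\<^sup>2 * (2 * (B * L8) / n)"
    using n0 by (intro mult_left_mono divide_right_mono) auto
  note mono = mult_mono[OF U2' this]
  have UV: "U * V \<le> 2 / 5 * R"
  proof (rule power2_le_imp_le)
    have "(U * V)\<^sup>2 = U\<^sup>2 * (\<tau>\<^sup>2 * (2 * L8 / n))"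
      using L n0 by (simp add: power_mult_distrib V_def)
    also have "\<dots> \<le> 2 / 25 * (\<tau>\<^sup>2 * (2 * (B * L8) / n))"
      using n0 L by (intro mono) auto
    also have "\<dots> = (2 / 5 * R)\<^sup>2"
      using L n0 B by (simp add: R_def power_mult_distrib power_divide)
    finally show "(U * V)\<^sup>2 \<le> (2 / 5 * R)\<^sup>2" .
  qed (use R in simp)
  have "(W + U * V) / (6 / 25 - U\<^sup>2) \<le> (12 / 5 * R) / (4 / 25)"
  proof (rule frac_le)
    show "W + U * V \<le> 12 / 5 * R"
      using UV by (simp add: W_def R_def)
  qed (use R U2' in auto)
  then have "(W + U * V) / (6 / 25 - U\<^sup>2) * U \<le> 15 * R * U"
    using nonneg(1) by (intro mult_right_mono) auto
  also have "\<dots> \<le> 58 * sqrt (B * m * Lm * L) * \<tau> / n"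
  proof (rule power2_le_imp_le)
    have "(15 * R * U)\<^sup>2 = 1350 * \<tau>\<^sup>2 * (B * m * L8 * L) / n\<^sup>2"
      using L n0 B by (simp add: R_def power_mult_distrib U2 power2_eq_square[of n])
    also have "\<dots> \<le> 3364 * \<tau>\<^sup>2 * (B * m * Lm * L) / n\<^sup>2"
      using L B m \<tau> by (intro divide_right_mono mult_mono) auto
    also have "\<dots> = (58 * sqrt (B * m * Lm * L) * \<tau> / n)\<^sup>2"
      using L B m by (simp add: power_mult_distrib power_divide)
    finally show "(15 * R * U)\<^sup>2 \<le> (58 * sqrt (B * m * Lm * L) * \<tau> / n)\<^sup>2" .
  qed (use n0 L B m \<tau> in auto)
  finally have "(W + U * V) / (6 / 25 - U\<^sup>2) * U \<le> 58 * sqrt (B * m * Lm * L) * \<tau> / n" .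
  moreover have "V = sqrt (2 * L8) * \<tau> / sqrt n"
    by (simp add: V_def real_sqrt_divide)
  ultimately show "V + (W + U * V) / (6 / 25 - U\<^sup>2) * U \<le> sqrt (2 * L8) * \<tau> / sqrt n + 58 * sqrt (B * m * Lm * L) * \<tau> / n"
    by linarith
qed

section \<open>The estimation error\<close>

text \<open>Probability enters only through four events; on their intersection the deterministic
  bound holds for every least squares solution.\<close>

lemma ols_isotropic_bound:
  fixes u :: "'a \<Rightarrow> 'b::euclidean_space" and eps :: "'a \<Rightarrow> real" and n :: nat and B \<delta> \<tau> :: real
  assumes M: "prob_space M" and u: "u \<in> borel_measurable M" "\<And>y. y \<in> space M \<Longrightarrow> (norm (u y))\<^sup>2 \<le> B"
    and cov: "\<And>x y. (\<integral> z. (u z \<bullet> x) * (u z \<bullet> y) \<partial>M) = x \<bullet> y"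
    and centered: "\<And>x. (\<integral> y. x \<bullet> u y \<partial>M) = 0"
    and uncorrelated: "\<And>x. (\<integral> y. eps y * (x \<bullet> u y) \<partial>M) = 0"
    and \<tau>: "0 < \<tau>" and sg: "subgaussian_fun M eps (\<tau>\<^sup>2)"
    and \<delta>: "0 < \<delta>" "\<delta> < 1"
    and n1: "18 * B * ln (4 * DIM('b) / \<delta>) \<le> n" and n2: "75 * DIM('b) * ln (4 / \<delta>) \<le> n"
  shows "\<exists>A \<in> sets (PiM {..<n} (\<lambda>_. M)). 1 - \<delta> \<le> measure (PiM {..<n} (\<lambda>_. M)) A \<and>
           (\<forall>X\<in>A. \<forall>a c. (\<forall>a' c'. (\<Sum>i<n. (eps (X i) - a - c \<bullet> u (X i))\<^sup>2) \<le> (\<Sum>i<n. (eps (X i) - a' - c' \<bullet> u (X i))\<^sup>2)) \<longrightarrow>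
              \<bar>a\<bar> \<le> sqrt (2 * ln (8 / \<delta>)) * \<tau> / sqrt n
                + 58 * sqrt (B * DIM('b) * ln (8 * DIM('b) / \<delta>) * ln (4 / \<delta>)) * \<tau> / n)"
proof -
  interpret prob_space M by fact
  interpret PP: prob_space "PiM {..<n} (\<lambda>_. M)"
    by (intro prob_space_PiM M)
  note [measurable] = u(1) subgaussian_fun_nn_integral_exp(1)[OF sg]
  define m where "m = real DIM('b)"
  define L where "L = ln (4 / \<delta>)"
  define L8 where "L8 = ln (8 / \<delta>)"
  have m: "1 \<le> m" "m \<le> B"
    using isotropic_integral_norm_square(3)[OF M u cov] DIM_positive[where 'a='b] by (auto simp: m_def Suc_le_eq)
  have B: "0 < B" using m by linarith
  have exp_L: "exp (- L) = \<delta> / 4" and exp_L8: "exp (- L8) = \<delta> / 8" and exp_Lm: "exp (- ln (4 * m / \<delta>)) = \<delta> / (4 * m)"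
    using \<delta> m by (simp_all add: L_def L8_def exp_minus)
  have L_le: "L \<le> ln (4 * m / \<delta>)" "L8 \<le> ln (8 * m / \<delta>)"
    using \<delta> m by (auto simp: L_def L8_def divide_right_mono)
  have L: "0 < L" "0 < L8"
    using \<delta> by (auto simp: L_def L8_def)
  have n0: "0 < n"
  proof -
    have "0 < 75 * m * L" using m L by simp
    also have "\<dots> \<le> n" using n2 by (simp add: m_def L_def)
    finally show ?thesis by simp
  qed
  \<comment> \<open>Thresholds for the means of \<open>u\<close>, \<open>eps\<close> and
    \<open>eps\<close> times \<open>u\<close>. In the tail bounds they produce the exponents
    \<open>3 / 2 * L\<close>, \<open>L8\<close> and \<open>L8\<close>.\<close>
  define U where "U = sqrt (6 * m * L / n)"
  define V where "V = \<tau> * sqrt (2 * L8 / n)"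
  define W where "W = 2 * \<tau> * sqrt (B * L8 / n)"
  have pos: "0 < U" "0 < V" "0 < W"
    using m L \<tau> n0 B by (auto simp: U_def V_def W_def)
  obtain E where E: "E \<in> PP.events" "1 - DIM('b) * exp (- real n / (18 * B)) \<le> PP.prob E"
      "\<And>X x. X \<in> E \<Longrightarrow> 6 / 25 * n * (norm x)\<^sup>2 \<le> (\<Sum>i<n. (u (X i) \<bullet> x)\<^sup>2)"
    using second_moment_lower_tail[OF M u(1) B u(2) cov n0] by blast
  have E_prob: "1 - \<delta> / 4 \<le> PP.prob E"
  proof -
    have "exp (- real n / (18 * B)) \<le> exp (- ln (4 * m / \<delta>))"
      using n1 B by (simp add: m_def field_simps)
    then have "m * exp (- real n / (18 * B)) \<le> m * (\<delta> / (4 * m))"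
      unfolding exp_Lm using m by (intro mult_left_mono) auto
    then show ?thesis
      using E(2) m by (simp add: m_def)
  qed
  define EU where "EU = {X \<in> space (PiM {..<n} (\<lambda>_. M)). norm (\<Sum>i<n. u (X i)) < U * n}"
  have EU_prob: "1 - \<delta> / 4 \<le> PP.prob EU"
  proof -
    \<comment> \<open>The minimizer of \<open>n * l\<^sup>2 * m - l * U * n\<close>. The condition
      on \<open>n\<close> involving \<open>B\<close> ensures that it satisfies
      \<open>l\<^sup>2 * B \<le> 1\<close>.\<close>
    define l where "l = U / (2 * m)"
    have U2: "U\<^sup>2 = 6 * m * L / n"
      using m L by (simp add: U_def)
    have "l\<^sup>2 * B = 3 / 2 * (L * B) / (m * n)"
      using m n0 by (simp add: l_def U2 power_divide power_mult_distrib) (simp add: field_simps power2_eq_square)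
    also have "\<dots> \<le> 1"
    proof -
      have "18 * (B * L) \<le> 18 * (B * ln (4 * m / \<delta>))"
        using B L_le by (intro mult_left_mono) auto
      also have "\<dots> \<le> n" using n1 by (simp add: m_def)
      also have "\<dots> \<le> m * n" using m by (simp add: mult_le_cancel_right1)
      finally have "18 * (B * L) \<le> m * n" .
      moreover have "0 \<le> B * L" using B L by simp
      ultimately have "3 / 2 * (L * B) \<le> m * n" by (simp add: mult.commute)
      then show ?thesis using m n0 by simp
    qed
    finally have l: "0 < l" "l\<^sup>2 * B \<le> 1"
      using pos m by (auto simp: l_def)
    have "n * (l\<^sup>2 * DIM('b)) - l * (U * n) = - (n * U\<^sup>2 / (4 * m))"
      using m by (simp add: l_def power2_eq_square field_simps flip: m_def)
    also have "\<dots> = - (3 / 2 * L)"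
      using m n0 by (simp add: U2)
    finally have eq: "n * (l\<^sup>2 * DIM('b)) - l * (U * n) = - (3 / 2 * L)" .
    \<comment> \<open>\<open>exp (- L)\<close> is already the share \<open>\<delta> / 4\<close>; the
      surplus \<open>exp (- (L / 2))\<close> is at most \<open>1 / 2\<close> and cancels the factor
      2.\<close>
    have "2 * exp (- (3 / 2 * L)) \<le> \<delta> / 4"
    proof -
      have "2 * exp (- (L / 2)) \<le> 1"
      proof (rule power2_le_imp_le)
        show "(2 * exp (- (L / 2)))\<^sup>2 \<le> 1\<^sup>2"
          using \<delta> by (simp add: power_mult_distrib exp_L flip: exp_double)
      qed simp
      then have "exp (- L) * (2 * exp (- (L / 2))) \<le> exp (- L) * 1"
        by (intro mult_left_mono) auto
      moreover have "exp (- (3 / 2 * L)) = exp (- L) * exp (- (L / 2))"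
        by (simp flip: exp_add)
      ultimately show ?thesis
        using exp_L by simp
    qed
    then show ?thesis
      using isotropic_sum_tail[OF M u cov centered l, of n "U * n"] by (simp add: EU_def eq)
  qed
  define EW where "EW = {X \<in> space (PiM {..<n} (\<lambda>_. M)). norm (\<Sum>i<n. eps (X i) *\<^sub>R u (X i)) < W * n}"
  have EW_prob: "1 - \<delta> / 4 \<le> PP.prob EW"
  proof -
    \<comment> \<open>The minimizer of
      \<open>n * l\<^sup>2 * B * \<tau>\<^sup>2 - l * W * n\<close>.\<close>
    define l where "l = W / (2 * B * \<tau>\<^sup>2)"
    have l: "0 < l" using pos B \<tau> by (simp add: l_def)
    have "n * (l\<^sup>2 * B * \<tau>\<^sup>2) - l * (W * n) = - (n * W\<^sup>2 / (4 * B * \<tau>\<^sup>2))"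
      using B \<tau> by (simp add: l_def power2_eq_square field_simps)
    also have "\<dots> = - L8"
      using B \<tau> n0 L by (simp add: W_def power_mult_distrib)
    finally show ?thesis
      using subgaussian_product_sum_tail[OF M u B sg uncorrelated l, of n "W * n"] by (simp add: EW_def exp_L8)
  qed
  define EV where "EV = {X \<in> space (PiM {..<n} (\<lambda>_. M)). \<bar>\<Sum>i<n. eps (X i)\<bar> < V * n}"
  have EV_prob: "1 - \<delta> / 4 \<le> PP.prob EV"
  proof -
    have "(V * n)\<^sup>2 / (2 * n * \<tau>\<^sup>2) = L8"
      using \<tau> n0 L by (simp add: V_def power_mult_distrib) (simp add: power2_eq_square)
    then have "- (V * n)\<^sup>2 / (2 * n * \<tau>\<^sup>2) = - L8" by simp
    then show ?thesis
      using subgaussian_sum_tail[OF M sg \<tau> n0, of "V * n"] pos n0 by (simp only: EV_def exp_L8) simp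
  qed
  have meas: "EU \<in> PP.events" "EV \<in> PP.events" "EW \<in> PP.events"
    unfolding EU_def EV_def EW_def by measurable
  let ?A = "(E \<inter> EU) \<inter> (EV \<inter> EW)"
  have "1 - ((\<delta> / 4 + \<delta> / 4) + (\<delta> / 4 + \<delta> / 4)) \<le> PP.prob ?A"
    by (intro PP.prob_Int_ge sets.Int E(1) meas E_prob EU_prob EV_prob EW_prob)
  then have "1 - \<delta> \<le> PP.prob ?A" by simp
  moreover have "?A \<in> PP.events"
    using E(1) meas by auto
  moreover have "\<bar>a\<bar> \<le> sqrt (2 * ln (8 / \<delta>)) * \<tau> / sqrt n
                + 58 * sqrt (B * DIM('b) * ln (8 * DIM('b) / \<delta>) * ln (4 / \<delta>)) * \<tau> / n"
    if X: "X \<in> ?A"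
      and min: "\<forall>a' c'. (\<Sum>i<n. (eps (X i) - a - c \<bullet> u (X i))\<^sup>2) \<le> (\<Sum>i<n. (eps (X i) - a' - c' \<bullet> u (X i))\<^sup>2)"
    for X a c
  proof -
    note arith = intercept_bound_arithmetic[OF m L L_le(2) \<tau>, of n, folded U_def V_def W_def]
    have n2': "75 * m * L \<le> n" using n2 by (simp add: m_def L_def)
    have "\<bar>a\<bar> \<le> V + (W + U * V) / (6 / 25 - U\<^sup>2) * U"
    proof (rule least_squares_intercept_bound[OF n0])
      show "(\<Sum>i<n. (eps (X i) - a - c \<bullet> u (X i))\<^sup>2) \<le> (\<Sum>i<n. (eps (X i) - a' - c' \<bullet> u (X i))\<^sup>2)" for a' c'
        using min by blast
      show "6 / 25 * n * (norm x)\<^sup>2 \<le> (\<Sum>i<n. (u (X i) \<bullet> x)\<^sup>2)" for x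
        using X E(3) by blast
      show "U\<^sup>2 < 6 / 25" by (rule arith(1)[OF n2'])
    qed (use X in \<open>auto simp: EU_def EV_def EW_def\<close>)
    also note arith(2)[OF n2']
    finally show ?thesis
      by (simp add: L_def L8_def m_def)
  qed
  ultimately show ?thesis by blast
qed

section \<open>Gram matrix and reduction to whitened control variates\<close>

lemma inner_gram:
  fixes h :: "'a \<Rightarrow> real ^ 'm"
  assumes int: "\<And>j k. integrable M (\<lambda>x. h x $ j * h x $ k)"
  shows "x \<bullet> (gram M h *v y) = (\<integral> z. (h z \<bullet> x) * (h z \<bullet> y) \<partial>M)"
proof -
  have "(h z \<bullet> x) * (h z \<bullet> y) = (\<Sum>j\<in>UNIV. \<Sum>k\<in>UNIV. (x $ j * y $ k) * (h z $ j * h z $ k))" for z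
    by (simp add: inner_vec_def sum_product mult_ac)
  then have "(\<integral> z. (h z \<bullet> x) * (h z \<bullet> y) \<partial>M) = (\<Sum>j\<in>UNIV. \<Sum>k\<in>UNIV. (x $ j * y $ k) * (\<integral> z. h z $ j * h z $ k \<partial>M))"
    by (simp add: Bochner_Integration.integral_sum Bochner_Integration.integrable_sum int)
  also have "\<dots> = x \<bullet> (gram M h *v y)"
    by (simp add: inner_vec_def gram_def matrix_vector_mult_def sum_distrib_left mult_ac)
  finally show ?thesis by simp
qed

text \<open>\<open>matrix_inv\<close> is defined by choice, so an inverse must first be shown to
  exist; the trivial kernel provides one.\<close>

lemma pd_op_matrix_inv:
  fixes A :: "real ^ 'm ^ 'm"
  assumes "pd_op ((*v) A)"
  shows "A *v (matrix_inv A *v x) = x"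
proof -
  have "\<exists>B. B ** A = mat 1"
    unfolding matrix_left_invertible_ker using pd_op_eq_0_iff[OF assms] by blast
  then have "\<exists>B. A ** B = mat 1 \<and> B ** A = mat 1"
    by (simp add: invertible_left_inverse[symmetric] invertible_def)
  then have "A ** matrix_inv A = mat 1"
    unfolding matrix_inv_def by (rule someI2_ex) simp
  then show ?thesis
    by (simp add: matrix_vector_mul_assoc)
qed

theorem theorem1:
  fixes M :: "'a measure" and f :: "'a \<Rightarrow> real" and h :: "'a \<Rightarrow> real ^ 'm"
    and betastar :: "real ^ 'm" and tau :: real and \<delta> :: real and n :: nat
  assumes P: "prob_space M"
    and f_L2: "f \<in> borel_measurable M" "integrable M (\<lambda>x. (f x)\<^sup>2)"
    and h_L2: "\<And>j. (\<lambda>x. h x $ j) \<in> borel_measurable M" "\<And>j. integrable M (\<lambda>x. (h x $ j)\<^sup>2)"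
    and h_centered: "\<And>j. (\<integral> x. h x $ j \<partial>M) = 0"
    and betastar_min: "\<And>\<beta>. (\<integral> x. (f x - (\<integral> y. f y \<partial>M) - betastar \<bullet> h x)\<^sup>2 \<partial>M)
                              \<le> (\<integral> x. (f x - (\<integral> y. f y \<partial>M) - \<beta> \<bullet> h x)\<^sup>2 \<partial>M)"
    and tau_pos: "tau > 0"
    and subG: "subgaussian_fun M (\<lambda>x. f x - (\<integral> y. f y \<partial>M) - betastar \<bullet> h x) (tau\<^sup>2)"
    and h_bounded: "\<exists>U. \<forall>x\<in>space M. \<forall>j. \<bar>h x $ j\<bar> \<le> U"
    and h_linindep: "\<And>c. (AE x in M. c \<bullet> h x = 0) \<Longrightarrow> c = 0"
    and \<delta>: "0 < \<delta>" "\<delta> < 1"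
    and n_large: "real n \<ge> max (18 * (SUP x\<in>space M. h x \<bullet> (matrix_inv (gram M h) *v h x)) * ln (4 * CARD('m) / \<delta>))
                                 (75 * CARD('m) * ln (4 / \<delta>))"
  shows "\<exists>A \<in> sets (Pi\<^sub>M {..<n} (\<lambda>_. M)).
           measure (Pi\<^sub>M {..<n} (\<lambda>_. M)) A \<ge> 1 - \<delta> \<and>
           (\<forall>X\<in>A. \<forall>a b. ols_minimizer n X f h a b \<longrightarrow>
              \<bar>a - (\<integral> y. f y \<partial>M)\<bar> \<le>
                sqrt (2 * ln (8 / \<delta>)) * tau / sqrt n
                + 58 * sqrt ((SUP x\<in>space M. h x \<bullet> (matrix_inv (gram M h) *v h x)) * CARD('m)
                             * ln (8 * CARD('m) / \<delta>) * ln (4 / \<delta>)) * tau / n)"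
proof -
  interpret prob_space M by fact
  define \<mu> where "\<mu> = (\<integral> y. f y \<partial>M)"
  define eps where "eps x = f x - \<mu> - betastar \<bullet> h x" for x
  define G where "G = gram M h"
  define B where "B = (SUP x\<in>space M. h x \<bullet> (matrix_inv G *v h x))"
  have sg: "subgaussian_fun M eps (tau\<^sup>2)"
    using subG by (simp add: eps_def[abs_def] \<mu>_def)
  note [measurable] = h_L2(1) subgaussian_fun_nn_integral_exp(1)[OF sg]
  have h_meas [measurable]: "h \<in> borel_measurable M"
    by (subst borel_measurable_euclidean_space) (auto simp: Basis_vec_def inner_axis)
  obtain U where U: "\<And>x j. x \<in> space M \<Longrightarrow> \<bar>h x $ j\<bar> \<le> U"
    using h_bounded by blast
  define K where "K = real CARD('m) * U"
  have K: "norm (h x) \<le> K" if "x \<in> space M" for x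
  proof -
    have "norm (h x) \<le> (\<Sum>j\<in>UNIV. \<bar>h x $ j\<bar>)" by (rule norm_le_l1_cart)
    also have "\<dots> \<le> (\<Sum>j\<in>(UNIV :: 'm set). U)" by (intro sum_mono U that)
    finally show ?thesis by (simp add: K_def)
  qed
  have inner_K: "\<bar>\<gamma> \<bullet> h x\<bar> \<le> norm \<gamma> * K" if "x \<in> space M" for \<gamma> x
    using Cauchy_Schwarz_ineq2[of \<gamma> "h x"] mult_left_mono[OF K[OF that], of "norm \<gamma>"] by simp
  have int_h: "integrable M (\<lambda>x. h x $ j)" for j
    by (rule integrable_const_bound[where B = U]) (auto intro!: AE_I2 U)
  have int_hh: "integrable M (\<lambda>x. h x $ j * h x $ k)" for j k
  proof (rule integrable_const_bound[where B = "U * U"])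
    have "\<bar>h x $ j\<bar> * \<bar>h x $ k\<bar> \<le> U * U" if "x \<in> space M" for x
      using U[OF that, of j] U[OF that, of k] by (intro mult_mono) auto
    then show "AE x in M. norm (h x $ j * h x $ k) \<le> U * U"
      by (auto intro!: AE_I2 simp: abs_mult)
  qed measurable
  have integral_inner: "(\<integral> x. \<gamma> \<bullet> h x \<partial>M) = 0" for \<gamma>
    by (simp add: inner_vec_def int_h h_centered)
  have hK: "(norm (h y))\<^sup>2 \<le> K\<^sup>2" if "y \<in> space M" for y
    using K[OF that] by (intro power_mono) auto
  note int_inner2 = integrable_inner_product_bounded[OF P h_meas hK]
  note G_inner = inner_gram[OF int_hh, folded G_def]
  \<comment> \<open>Linear independence enters here: a vanishing quadratic form means that the
    combination vanishes almost everywhere.\<close>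
  have pdG: "pd_op ((*v) G)"
  proof (rule pd_opI)
    show "(G *v x) \<bullet> y = x \<bullet> (G *v y)" for x y
      by (subst inner_commute) (simp add: G_inner mult.commute)
    fix x :: "real ^ 'm" assume x: "x \<noteq> 0"
    have "(\<integral> z. (h z \<bullet> x) * (h z \<bullet> x) \<partial>M) \<noteq> 0"
    proof
      assume "(\<integral> z. (h z \<bullet> x) * (h z \<bullet> x) \<partial>M) = 0"
      then have "AE z in M. (h z \<bullet> x) * (h z \<bullet> x) = 0"
        by (subst (asm) integral_nonneg_eq_0_iff_AE[OF int_inner2]) auto
      then have "AE z in M. x \<bullet> h z = 0" by (auto simp: inner_commute)
      then show False using h_linindep x by blast
    qed
    moreover have "0 \<le> (\<integral> z. (h z \<bullet> x) * (h z \<bullet> x) \<partial>M)"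
      by (intro integral_nonneg_AE) auto
    ultimately show "0 < x \<bullet> (G *v x)" unfolding G_inner by linarith
  qed simp
  obtain S :: "real ^ 'm \<Rightarrow> real ^ 'm" where S: "linear S" "surj S" "\<And>x y. S x \<bullet> (G *v (S y)) = x \<bullet> y"
    using pd_op_whitening[OF pdG] by blast
  \<comment> \<open>The whitened control variates: taking the adjoint moves \<open>S\<close> onto
    the test vectors, where its isometry property gives identity covariance.\<close>
  define u where "u y = adjoint S (h y)" for y
  have u_inner: "x \<bullet> u y = S x \<bullet> h y" for x y
    by (simp add: u_def adjoint_works[OF S(1)])
  have u_inner': "u y \<bullet> x = h y \<bullet> S x" for x y
    by (metis u_inner inner_commute)
  have u_meas: "u \<in> borel_measurable M"
    unfolding u_def using adjoint_linear[OF S(1)]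
    by (intro borel_measurable_continuous_on[OF _ h_meas] linear_continuous_on) (simp add: linear_conv_bounded_linear)
  \<comment> \<open>Writing \<open>matrix_inv G *v h y\<close> as \<open>S c\<close> and testing
    against every \<open>x\<close> gives \<open>u y = c\<close>, so the expression under the
    supremum in \<open>B\<close> is a squared norm.\<close>
  have u_norm: "(norm (u y))\<^sup>2 = h y \<bullet> (matrix_inv G *v h y)" for y
  proof -
    obtain c where c: "matrix_inv G *v h y = S c" using S(2) by (metis surjD)
    then have hy: "h y = G *v (S c)" using pd_op_matrix_inv[OF pdG, of "h y"] by simp
    have "x \<bullet> u y = x \<bullet> c" for x
      by (simp add: u_inner hy S(3))
    then have "u y = c" by (metis vector_eq_ldot)
    then show ?thesis
      unfolding c by (simp add: power2_norm_eq_inner flip: u_inner')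
  qed
  have u_bound: "(norm (u y))\<^sup>2 \<le> B" if "y \<in> space M" for y
    unfolding u_norm B_def
  \<comment> \<open>A real supremum dominates its members only if they are bounded above; the
    boundedness of \<open>h\<close> ensures this.\<close>
  proof (rule cSUP_upper[OF that])
    have "h x \<bullet> (matrix_inv G *v h x) \<le> K * (onorm ((*v) (matrix_inv G)) * K)" if "x \<in> space M" for x
    proof -
      have "norm (matrix_inv G *v h x) \<le> onorm ((*v) (matrix_inv G)) * norm (h x)"
        by (rule onorm) simp
      also have "\<dots> \<le> onorm ((*v) (matrix_inv G)) * K"
        by (intro mult_left_mono K that onorm_pos_le) simp
      finally have "norm (h x) * norm (matrix_inv G *v h x) \<le> K * (onorm ((*v) (matrix_inv G)) * K)"
        using K[OF that] by (intro mult_mono) (auto intro: order_trans[OF norm_ge_zero])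
      then show ?thesis
        using norm_cauchy_schwarz[of "h x" "matrix_inv G *v h x"] by linarith
    qed
    then show "bdd_above ((\<lambda>x. h x \<bullet> (matrix_inv G *v h x)) ` space M)"
      by (auto simp: bdd_above_def)
  qed
  have cov: "(\<integral> z. (u z \<bullet> x) * (u z \<bullet> y) \<partial>M) = x \<bullet> y" for x y
    by (simp add: u_inner' S(3) flip: G_inner)
  \<comment> \<open>Domination by \<open>cosh\<close> turns the exponential moments of
    \<open>eps\<close> into integrability of \<open>eps\<close> and its square.\<close>
  have sq_le: "z\<^sup>2 \<le> 4 * cosh (1 * z)" "\<bar>z\<bar> \<le> 4 * cosh (1 * z)" for z :: real
  proof -
    have "1 + \<bar>z\<bar> + z\<^sup>2 / 2 \<le> exp \<bar>z\<bar>"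
      using exp_lower_Taylor_quadratic[of "\<bar>z\<bar>"] by simp
    moreover have "exp \<bar>z\<bar> \<le> 2 * cosh z"
      by (cases "0 \<le> z") (auto simp: cosh_field_def)
    moreover have "0 \<le> z\<^sup>2" by simp
    ultimately show "z\<^sup>2 \<le> 4 * cosh (1 * z)" "\<bar>z\<bar> \<le> 4 * cosh (1 * z)"
      unfolding mult_1 by linarith+
  qed
  note int_cosh = integrable_mult_right[OF subgaussian_fun_integral_cosh(1)[OF sg, of 1], of 4]
  have int_eps: "integrable M eps" and int_eps2: "integrable M (\<lambda>x. (eps x)\<^sup>2)"
    by (rule Bochner_Integration.integrable_bound[OF int_cosh]; use sq_le in \<open>auto intro!: AE_I2\<close>)+
  have int_eps_h: "integrable M (\<lambda>x. eps x * (\<gamma> \<bullet> h x))" for \<gamma>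
  proof (rule Bochner_Integration.integrable_bound[OF integrable_mult_right[OF int_eps, of "norm \<gamma> * K"]])
    show "AE x in M. norm (eps x * (\<gamma> \<bullet> h x)) \<le> norm (norm \<gamma> * K * eps x)"
    proof (rule AE_I2)
      fix x assume x: "x \<in> space M"
      have "\<bar>eps x\<bar> * \<bar>\<gamma> \<bullet> h x\<bar> \<le> \<bar>eps x\<bar> * \<bar>norm \<gamma> * K\<bar>"
        using inner_K[OF x, of \<gamma>] by (intro mult_left_mono) auto
      then show "norm (eps x * (\<gamma> \<bullet> h x)) \<le> norm (norm \<gamma> * K * eps x)"
        by (simp add: abs_mult mult_ac)
    qed
  qed measurable
  \<comment> \<open>The population normal equations, from the minimality of \<open>betastar\<close>
    along the line in direction \<open>\<gamma>\<close>.\<close>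
  have uncorrelated: "(\<integral> x. eps x * (\<gamma> \<bullet> h x) \<partial>M) = 0" for \<gamma>
  proof (rule nonneg_quadratic_linear_coeff_eq_0)
    fix t :: real
    have int_gg: "integrable M (\<lambda>x. (\<gamma> \<bullet> h x)\<^sup>2)"
      using int_inner2[of \<gamma> \<gamma>] by (simp add: power2_eq_square inner_commute)
    have "(\<integral> x. (eps x)\<^sup>2 \<partial>M) \<le> (\<integral> x. (eps x - t * (\<gamma> \<bullet> h x))\<^sup>2 \<partial>M)"
      using betastar_min[of "betastar + t *\<^sub>R \<gamma>"] by (simp add: eps_def \<mu>_def inner_add_left algebra_simps)
    also have "\<dots> = (\<integral> x. (eps x)\<^sup>2 + (t\<^sup>2 * (\<gamma> \<bullet> h x)\<^sup>2 - 2 * t * (eps x * (\<gamma> \<bullet> h x))) \<partial>M)"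
      by (intro Bochner_Integration.integral_cong refl) (simp add: power2_diff power_mult_distrib mult_ac)
    also have "\<dots> = (\<integral> x. (eps x)\<^sup>2 \<partial>M) + (t\<^sup>2 * (\<integral> x. (\<gamma> \<bullet> h x)\<^sup>2 \<partial>M) - 2 * t * (\<integral> x. eps x * (\<gamma> \<bullet> h x) \<partial>M))"
      by (simp add: int_eps2 int_gg int_eps_h)
    finally show "0 \<le> t\<^sup>2 * (\<integral> x. (\<gamma> \<bullet> h x)\<^sup>2 \<partial>M) - 2 * t * (\<integral> x. eps x * (\<gamma> \<bullet> h x) \<partial>M)"
      by simp
  qed
  have n1: "18 * B * ln (4 * DIM(real ^ 'm) / \<delta>) \<le> n" and n2: "75 * DIM(real ^ 'm) * ln (4 / \<delta>) \<le> n"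
    using n_large by (simp_all add: B_def G_def)
  have u_centered: "(\<integral> y. x \<bullet> u y \<partial>M) = 0" and u_uncorrelated: "(\<integral> y. eps y * (x \<bullet> u y) \<partial>M) = 0" for x
    by (simp_all add: u_inner integral_inner uncorrelated)
  have dim: "DIM(real ^ 'm) = CARD('m)" by simp
  obtain A where A: "A \<in> sets (PiM {..<n} (\<lambda>_. M))" "1 - \<delta> \<le> measure (PiM {..<n} (\<lambda>_. M)) A"
    and A_bound: "\<forall>X\<in>A. \<forall>a c. (\<forall>a' c'. (\<Sum>i<n. (eps (X i) - a - c \<bullet> u (X i))\<^sup>2) \<le> (\<Sum>i<n. (eps (X i) - a' - c' \<bullet> u (X i))\<^sup>2)) \<longrightarrow>
              \<bar>a\<bar> \<le> sqrt (2 * ln (8 / \<delta>)) * tau / sqrt n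
                + 58 * sqrt (B * CARD('m) * ln (8 * CARD('m) / \<delta>) * ln (4 / \<delta>)) * tau / n"
    using ols_isotropic_bound[OF P u_meas u_bound cov u_centered u_uncorrelated tau_pos sg \<delta> n1 n2]
    unfolding dim by blast
  have "\<bar>a - \<mu>\<bar> \<le> sqrt (2 * ln (8 / \<delta>)) * tau / sqrt n
                + 58 * sqrt (B * CARD('m) * ln (8 * CARD('m) / \<delta>) * ln (4 / \<delta>)) * tau / n"
    if X: "X \<in> A" and ols: "ols_minimizer n X f h a b" for X a b
  proof -
    \<comment> \<open>A fit \<open>(a, b)\<close> of \<open>f\<close> on \<open>h\<close> becomes
      the fit \<open>(a - \<mu>, c)\<close> of \<open>eps\<close> on \<open>u\<close> with
      \<open>b = betastar + S c\<close>, leaving residuals unchanged; surjectivity of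
      \<open>S\<close> reaches every \<open>b\<close>.\<close>
    have shift: "eps y - (a' - \<mu>) - c \<bullet> u y = f y - a' - (betastar + S c) \<bullet> h y" for y a' c
      by (simp add: eps_def u_inner inner_add_left)
    obtain c where c: "b - betastar = S c" using S(2) by (metis surjD)
    then have b: "b = betastar + S c" by (simp add: algebra_simps)
    show ?thesis
    proof (rule A_bound[rule_format, OF X])
      show "(\<Sum>i<n. (eps (X i) - (a - \<mu>) - c \<bullet> u (X i))\<^sup>2) \<le> (\<Sum>i<n. (eps (X i) - a' - c' \<bullet> u (X i))\<^sup>2)" for a' c'
      proof -
        have eq: "eps y - a' - c' \<bullet> u y = f y - (a' + \<mu>) - (betastar + S c') \<bullet> h y" for y
          using shift[of y "a' + \<mu>" c'] by simp
        then show ?thesis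
          using ols unfolding ols_minimizer_def shift eq b by blast
      qed
    qed
  qed
  then show ?thesis
    using A unfolding \<mu>_def B_def G_def by blast
qed

end
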